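(* Let $K$ be a perfect field of characteristic $p>0$ and let $R=K[x_1,\dots,x_d]$ be a standard graded polynomial ring equipped with a monomial order $<$. Let $P\subseteq R$ be a homogeneous prime ideal such that $\mathrm{in}_<(P)$ is radical. Let $$S=\bigoplus_{n\ge0}\mathrm{in}_<(P^{(n)})T^n\subseteq R[T],\qquad \mathcal J=\bigoplus_{n\ge0}\mathrm{in}_<(P^{(n+1)})T^n\subseteq S,\qquad G=S/\mathcal J.$$ Assume that $S$ is Noetherian and let $b_1,\dots,b_m$ be the generating degrees of $S$ as an $R$-algebra. Assume that $p>\mathrm{lcm}(b_1,\dots,b_m)$ and that $G$ is reduced. Then $\mathrm{in}_<(P^{(n)})=\mathrm{in}_<(P)^{(n)}$ for all $n\ge1$.
   Context: $T$ is a variable. $\mathrm{in}_<(I)$ denotes the initial ideal of $I$ with respect to $<$. For an ideal $I$ of $R$ and $n\ge0$, $I^{(n)}=I^nR_U\cap R$, where $U$ is the complement of the union of the minimal primes of $I$. $S$ is graded by the exponent of $T$, with degree-zero part $R$; the generating degrees of $S$ as an $R$-algebra are the (positive) degrees of a minimal system of homogeneous $R$-algebra generators of $S$. *)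

theory Defs
  imports "HOL-Library.Poly_Mapping" "HOL-Algebra.Algebra" "HOL-Algebra.Algebraic_Closure_Type"
begin

text \<open>
  The polynomial ring \<open>K[x\<^sub>1,\<dots>,x\<^sub>d]\<close> is the type \<open>('n, 'k) mpoly\<close>, where the
  variables are indexed by a finite type \<open>'n\<close> with \<open>d = CARD('n)\<close>. The index type is linearly
  ordered, as \<open>{1,\<dots>,d}\<close> is; the library uses this order only to know that the polynomial ring
  is an integral domain, and it is unrelated to the monomial order. Ideals, quotients etc. are
  those of \<^theory>\<open>HOL-Algebra.Algebra\<close>, via \<^const>\<open>ring_of_type_algebra\<close>.
\<close>

type_synonym 'n monomial = "'n \<Rightarrow>\<^sub>0 nat"
type_synonym ('n, 'k) mpoly = "'n monomial \<Rightarrow>\<^sub>0 'k"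

definition subset_ring :: "'a::comm_ring_1 set \<Rightarrow> 'a ring" where
  "subset_ring A = ring_of_type_algebra\<lparr>carrier := A\<rparr>"

definition perfect_field :: "'k::field itself \<Rightarrow> bool" where
  "perfect_field _ \<longleftrightarrow> CHAR('k) = 0 \<or> surj (\<lambda>x::'k. x ^ CHAR('k))"


subsection \<open>Ideals of an integral domain, localization and symbolic powers\<close>

definition radical_ideal :: "'a::comm_ring_1 set \<Rightarrow> bool" where
  "radical_ideal I \<longleftrightarrow> ideal I ring_of_type_algebra \<and> (\<forall>r n. r ^ n \<in> I \<longrightarrow> r \<in> I)"

fun ideal_power :: "'a::comm_ring_1 set \<Rightarrow> nat \<Rightarrow> 'a set" where
  "ideal_power I 0 = UNIV"
| "ideal_power I (Suc n) = ideal_prod ring_of_type_algebra I (ideal_power I n)"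

definition minimal_primes :: "'a::comm_ring_1 set \<Rightarrow> 'a set set" where
  "minimal_primes I = {Q. primeideal Q ring_of_type_algebra \<and> I \<subseteq> Q \<and>
     (\<forall>Q'. primeideal Q' ring_of_type_algebra \<and> I \<subseteq> Q' \<and> Q' \<subseteq> Q \<longrightarrow> Q' = Q)}"

text \<open>
  The localization \<open>R\<^sub>U\<close> as a subring of the fraction field of \<open>R\<close>. The multiplicative set
  used below contains 0 only for the unit ideal, all of whose symbolic powers are still \<open>R\<close>.
\<close>

definition localization :: "'a::idom set \<Rightarrow> 'a fract set" where
  "localization U = {Fract r u | r u. u \<in> U}"

text \<open>The extension \<open>I R\<^sub>U\<close>.\<close>

definition extended_ideal :: "'a::idom set \<Rightarrow> 'a set \<Rightarrow> 'a fract set" where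
  "extended_ideal U I = genideal (subset_ring (localization U)) (to_fract ` I)"

definition symbolic_power :: "'a::idom set \<Rightarrow> nat \<Rightarrow> 'a set" where
  "symbolic_power I n =
     {r. to_fract r \<in> extended_ideal (- \<Union>(minimal_primes I)) (ideal_power I n)}"


subsection \<open>Homogeneous ideals, monomial orders and initial ideals\<close>

definition monomial_degree :: "'n::finite monomial \<Rightarrow> nat" where
  "monomial_degree m = (\<Sum>i\<in>UNIV. Poly_Mapping.lookup m i)"

definition homogeneous :: "('n::finite, 'k::zero) mpoly \<Rightarrow> bool" where
  "homogeneous f \<longleftrightarrow> (\<exists>n. \<forall>m\<in>Poly_Mapping.keys f. monomial_degree m = n)"

definition homogeneous_ideal :: "('n::finite, 'k::field) mpoly set \<Rightarrow> bool" where
  "homogeneous_ideal I \<longleftrightarrow>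
     (\<exists>H. (\<forall>h\<in>H. homogeneous h) \<and> I = genideal ring_of_type_algebra H)"

definition monomial_order :: "('n monomial \<Rightarrow> 'n monomial \<Rightarrow> bool) \<Rightarrow> bool" where
  "monomial_order ord \<longleftrightarrow>
     reflp ord \<and> transp ord \<and> antisymp ord \<and> totalp ord \<and>
     (\<forall>m. ord 0 m) \<and> (\<forall>a b c. ord a b \<longrightarrow> ord (a + c) (b + c))"

definition is_leading_monomial ::
  "('n monomial \<Rightarrow> 'n monomial \<Rightarrow> bool) \<Rightarrow> ('n, 'k::zero) mpoly \<Rightarrow> 'n monomial \<Rightarrow> bool" where
  "is_leading_monomial ord f m \<longleftrightarrow>
     m \<in> Poly_Mapping.keys f \<and> (\<forall>m'\<in>Poly_Mapping.keys f. ord m' m)"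

definition initial_ideal ::
  "('n monomial \<Rightarrow> 'n monomial \<Rightarrow> bool) \<Rightarrow> ('n, 'k::field) mpoly set \<Rightarrow> ('n, 'k) mpoly set" where
  "initial_ideal ord I =
     genideal ring_of_type_algebra
       {Poly_Mapping.single m 1 | m. \<exists>f\<in>I. is_leading_monomial ord f m}"


subsection \<open>Graded subalgebras of \<open>R[T]\<close>\<close>

text \<open>\<open>\<Oplus>\<^sub>n I\<^sub>n T\<^sup>n\<close>, for a sequence of ideals of \<open>R\<close>, as a subset of \<open>R[T]\<close>.\<close>

definition graded_sum :: "(nat \<Rightarrow> 'a::comm_ring_1 set) \<Rightarrow> 'a poly set" where
  "graded_sum I = {f. \<forall>n. Polynomial.coeff f n \<in> I n}"

definition generated_algebra :: "'a::comm_ring_1 poly set \<Rightarrow> 'a poly set" where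
  "generated_algebra B = generate_ring ring_of_type_algebra (range (\<lambda>r. [:r:]) \<union> B)"

text \<open>
  A minimal system is one that is irredundant. When \<open>A\<close> is the algebra of initial ideals
  considered here, the set of degrees of the generators does not depend on the system:
  \<open>b \<ge> 1\<close> occurs iff the \<open>b\<close>-th component of \<open>A\<close> is not generated by components of smaller degree.
\<close>

definition minimal_homogeneous_generators :: "'a::comm_ring_1 poly set \<Rightarrow> 'a poly set \<Rightarrow> bool" where
  "minimal_homogeneous_generators A B \<longleftrightarrow>
     (\<forall>g\<in>B. \<exists>r n. g = Polynomial.monom r n) \<and>
     generated_algebra B = A \<and>
     (\<forall>C. C \<subset> B \<longrightarrow> generated_algebra C \<noteq> A)"

definition reduced_ring :: "('a, 'b) ring_scheme \<Rightarrow> bool" where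
  "reduced_ring G \<longleftrightarrow>
     (\<forall>x\<in>carrier G. \<forall>n::nat. x [^]\<^bsub>G\<^esub> n = \<zero>\<^bsub>G\<^esub> \<longrightarrow> x = \<zero>\<^bsub>G\<^esub>)"

end

theory Submission
  imports Defs
begin

text \<open>
  Let \<open>M = in(P)\<close>, a squarefree monomial ideal; its minimal primes are the ideals
  \<open>Q\<^sub>A = (x\<^sub>i : i \<in> A)\<close> for the minimal transversals \<open>A\<close> of its monomials, and \<open>M\<^sup>(\<^sup>n\<^sup>)\<close> is spanned
  by the monomials of \<open>A\<close>-degree at least \<open>n\<close> for all these \<open>A\<close>.

  \<open>in(P\<^sup>(\<^sup>n\<^sup>)) \<subseteq> M\<^sup>(\<^sup>n\<^sup>)\<close>: Hasse derivatives of order less than \<open>n\<close> map \<open>P\<^sup>(\<^sup>n\<^sup>)\<close> into \<open>P\<close>. If the leading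
  monomial \<open>x\<^sup>u\<close> of \<open>f \<in> P\<^sup>(\<^sup>n\<^sup>)\<close> had \<open>A\<close>-degree less than \<open>n\<close>, then differentiating \<open>f\<close> by the
  restriction of \<open>u\<close> to \<open>A\<close> would give an element of \<open>P\<close> whose leading monomial avoids \<open>A\<close>; the
  coefficient \<open>binom(u, u|\<^sub>A)\<close> of that monomial is 1 in every characteristic.

  \<open>M\<^sup>(\<^sup>n\<^sup>) \<subseteq> in(P\<^sup>(\<^sup>n\<^sup>))\<close>: as \<open>G\<close> is reduced, \<open>v(u) = max {n. x\<^sup>u \<in> in(P\<^sup>(\<^sup>n\<^sup>))}\<close> satisfies
  \<open>v(k u) = k v(u)\<close>, and it is superadditive. An integral version of the Hahn-Banach theorem
  yields a linear form with natural coefficients that dominates \<open>v\<close> on the face of \<open>u\<close> and agrees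
  with it at \<open>u\<close>. Positive integers being at least 1, this form is bounded below by the degree
  along some minimal transversal.
\<close>

subsection \<open>Integral superlinear functions\<close>

text \<open>Lattice analogue of a concave, positively homogeneous function on a cone. Closure of
  \<open>C\<close> under sums and natural multiples is part of the notion, so \<open>C\<close> plays
  the role of the cone.\<close>

definition superlinear_on :: "('n \<Rightarrow> int) set \<Rightarrow> (('n \<Rightarrow> int) \<Rightarrow> int) \<Rightarrow> bool" where
  "superlinear_on C g \<longleftrightarrow>
     (\<forall>x\<in>C. \<forall>y\<in>C. (\<lambda>i. x i + y i) \<in> C \<and> g x + g y \<le> g (\<lambda>i. x i + y i)) \<and>
     (\<forall>x\<in>C. \<forall>k::nat. (\<lambda>i. int k * x i) \<in> C \<and> g (\<lambda>i. int k * x i) = int k * g x)"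

lemma superlinear_on_add:
  assumes "superlinear_on C g" "x \<in> C" "y \<in> C"
  shows "(\<lambda>i. x i + y i) \<in> C" "g x + g y \<le> g (\<lambda>i. x i + y i)"
  using assms unfolding superlinear_on_def by blast+

lemma superlinear_on_scale:
  assumes "superlinear_on C g" "x \<in> C"
  shows "(\<lambda>i. int k * x i) \<in> C" "g (\<lambda>i. int k * x i) = int k * g x"
  using assms unfolding superlinear_on_def by blast+

lemma superlinear_0: "superlinear_on UNIV g \<Longrightarrow> g (\<lambda>i. 0) = 0"
  using superlinear_on_scale(2)[of UNIV g "\<lambda>i. 0" 0] by simp

text \<open>The tail takes only finitely many integer values; once it reaches their maximum,
  monotonicity keeps it there.\<close>

lemma eventually_const_int:
  fixes s :: "nat \<Rightarrow> int"
  assumes mono: "\<And>k. k \<ge> N \<Longrightarrow> s k \<le> s (Suc k)" and bound: "\<And>k. k \<ge> N \<Longrightarrow> s k \<le> b"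
  shows "\<exists>c. \<forall>\<^sub>F k in sequentially. s k = c"
proof -
  have mono': "s k \<le> s l" if "N \<le> k" "k \<le> l" for k l
    using that(2) by (rule inc_induct) (use that(1) mono in \<open>auto intro: order_trans\<close>)
  define V where "V = s ` {N..}"
  have sub: "V \<subseteq> {s N..b}"
    using mono' bound by (auto simp: V_def)
  have "finite V" using sub finite_subset by blast
  moreover have "V \<noteq> {}" by (auto simp: V_def)
  ultimately obtain K where K: "K \<ge> N" "s K = Max V"
    using Max_in[of V] by (metis V_def atLeast_iff imageE)
  have "s k = Max V" if "k \<ge> K" for k
    using mono'[of K k] that K Max_ge[OF \<open>finite V\<close>, of "s k"] by (force simp: V_def)
  then show ?thesis unfolding eventually_sequentially by blast
qed

text \<open>
  The one-sided directional derivative of \<open>g\<close> at \<open>e\<close>: since \<open>g\<close> is integer-valued, the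
  difference quotients stabilise, so the derivative is again integer-valued.
\<close>
lemma superlinear_linearize:
  fixes g :: "('n \<Rightarrow> int) \<Rightarrow> int"
  assumes g: "superlinear_on C g" and e: "e \<in> C"
    and absorb: "\<And>x. \<forall>\<^sub>F k in sequentially. (\<lambda>i. int k * e i + x i) \<in> C"
  obtains h where "superlinear_on UNIV h" "\<And>x. x \<in> C \<Longrightarrow> g x \<le> h x"
    "h e = g e" "h (\<lambda>i. - e i) = - g e"
proof -
  \<comment> \<open>By homogeneity this is \<open>k\<close> times the increment of \<open>g\<close>
    from \<open>e\<close> to \<open>e + x/k\<close>, written without leaving the lattice.\<close>
  define s where "s x k = g (\<lambda>i. int k * e i + x i) - int k * g e" for x k
  have ge: "(\<lambda>i. int k * e i) \<in> C" "g (\<lambda>i. int k * e i) = int k * g e" for k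
    using superlinear_on_scale[OF g e] by auto
  have "\<exists>c. \<forall>\<^sub>F k in sequentially. s x k = c" for x
  proof -
    obtain N where N: "\<And>k. k \<ge> N \<Longrightarrow> (\<lambda>i. int k * e i + x i) \<in> C"
      using absorb[of x] unfolding eventually_sequentially by blast
    \<comment> \<open>Absorbing \<open>- x\<close> as well gives the upper bound:
      \<open>k e + x\<close> and \<open>N' e - x\<close> add up to a multiple of \<open>e\<close>,
      where \<open>g\<close> is known.\<close>
    obtain N' where N': "(\<lambda>i. int N' * e i + - x i) \<in> C"
      using absorb[of "\<lambda>i. - x i"] unfolding eventually_sequentially by blast
    show ?thesis
    proof (rule eventually_const_int)
      fix k assume k: "N \<le> k"
      have "g (\<lambda>i. int k * e i + x i) + g e \<le> g (\<lambda>i. (int k * e i + x i) + e i)"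
        using superlinear_on_add(2)[OF g N[OF k] e] .
      also have "(\<lambda>i. (int k * e i + x i) + e i) = (\<lambda>i. int (Suc k) * e i + x i)"
        by (auto simp: algebra_simps)
      finally show "s x k \<le> s x (Suc k)"
        by (simp add: s_def algebra_simps)
    next
      fix k assume k: "N \<le> k"
      have "g (\<lambda>i. int k * e i + x i) + g (\<lambda>i. int N' * e i + - x i)
          \<le> g (\<lambda>i. (int k * e i + x i) + (int N' * e i + - x i))"
        using superlinear_on_add(2)[OF g N[OF k] N'] .
      also have "(\<lambda>i. (int k * e i + x i) + (int N' * e i + - x i)) = (\<lambda>i. int (k + N') * e i)"
        by (auto simp: algebra_simps)
      also have "g \<dots> = int (k + N') * g e" by (rule ge)
      finally show "s x k \<le> int N' * g e - g (\<lambda>i. int N' * e i + - x i)"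
        by (simp add: s_def algebra_simps)
    qed
  qed
  then obtain h where h: "\<And>x. \<forall>\<^sub>F k in sequentially. s x k = h x" by metis
  have eqI: "a = b" if "\<forall>\<^sub>F k in sequentially. a = (b::int)" for a b
    using eventually_happens'[OF _ that] by simp
  show ?thesis
  proof
    have "h x + h y \<le> h (\<lambda>i. x i + y i)" for x y
    proof -
      have "\<forall>\<^sub>F k in sequentially. s (\<lambda>i. x i + y i) (k + k) = h (\<lambda>i. x i + y i)"
        by (rule eventually_compose_filterlim[OF h])
           (auto simp: filterlim_at_top eventually_sequentially intro: trans_le_add1)
      then have "\<forall>\<^sub>F k in sequentially. h x + h y \<le> h (\<lambda>i. x i + y i)"
        using h[of x] h[of y] absorb[of x] absorb[of y]
      proof eventually_elim
        case (elim k)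
        have "g (\<lambda>i. int k * e i + x i) + g (\<lambda>i. int k * e i + y i)
           \<le> g (\<lambda>i. (int k * e i + x i) + (int k * e i + y i))"
          using superlinear_on_add(2)[OF g elim(4,5)] .
        \<comment> \<open>Adding the two points doubles the multiple of \<open>e\<close>, which is
          why the limit for \<open>x + y\<close> is taken along \<open>k + k\<close>.\<close>
        also have "(\<lambda>i. (int k * e i + x i) + (int k * e i + y i))
            = (\<lambda>i. int (k + k) * e i + (x i + y i))"
          by (auto simp: algebra_simps)
        finally have "s x k + s y k \<le> s (\<lambda>i. x i + y i) (k + k)"
          by (simp add: s_def algebra_simps)
        then show ?case using elim by simp
      qed
      then show ?thesis using eventually_happens' by force
    qed
    moreover have "h (\<lambda>i. int m * x i) = int m * h x" for m x
    proof (cases "m = 0")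
      case True
      have "s (\<lambda>i. 0) k = 0" for k
        using ge(2) by (simp add: s_def)
      then show ?thesis using h[of "\<lambda>i. 0"] True by simp
    next
      case False
      have "\<forall>\<^sub>F k in sequentially. s (\<lambda>i. int m * x i) (m * k) = h (\<lambda>i. int m * x i)"
        by (rule eventually_compose_filterlim[OF h])
           (use False in \<open>simp add: mult_nat_left_at_top\<close>)
      then have "\<forall>\<^sub>F k in sequentially. h (\<lambda>i. int m * x i) = int m * h x"
        using h[of x] absorb[of x]
      proof eventually_elim
        case (elim k)
        have "(\<lambda>i. int (m * k) * e i + int m * x i) = (\<lambda>i. int m * (int k * e i + x i))"
          by (auto simp: algebra_simps)
        then have "s (\<lambda>i. int m * x i) (m * k) = int m * s x k"
          using superlinear_on_scale(2)[OF g elim(3), of m] by (simp add: s_def algebra_simps)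
        then show ?case using elim by simp
      qed
      then show ?thesis by (rule eqI)
    qed
    ultimately show "superlinear_on UNIV h" unfolding superlinear_on_def by simp
  next
    fix x assume x: "x \<in> C"
    have "g x \<le> s x k" for k
      using superlinear_on_add(2)[OF g ge(1) x, of k] ge(2) by (simp add: s_def)
    moreover obtain k where "s x k = h x"
      using eventually_happens'[OF _ h[of x]] by auto
    ultimately show "g x \<le> h x" by metis
  next
    have "(\<lambda>i. int k * e i + e i) = (\<lambda>i. int (Suc k) * e i)" for k
      by (auto simp: algebra_simps)
    then have "s e k = g e" for k
      using ge(2)[of "Suc k"] by (simp only: s_def) (simp add: algebra_simps)
    then show "h e = g e" using h[of e] by simp
  next
    \<comment> \<open>The index \<open>Suc k\<close> keeps the multiple of \<open>e\<close> natural
      after subtracting \<open>e\<close>.\<close>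
    have "(\<lambda>i. int (Suc k) * e i + - e i) = (\<lambda>i. int k * e i)" for k
      by (auto simp: algebra_simps)
    then have "s (\<lambda>i. - e i) (Suc k) = - g e" for k
      using ge(2)[of k] by (simp only: s_def) (simp add: algebra_simps)
    moreover have "\<forall>\<^sub>F k in sequentially. s (\<lambda>i. - e i) (Suc k) = h (\<lambda>i. - e i)"
      using h[of "\<lambda>i. - e i"] by (subst eventually_sequentially_Suc)
    ultimately show "h (\<lambda>i. - e i) = - g e" by simp
  qed
qed

text \<open>Superadditivity gives one inequality; applied to \<open>x + y\<close> and
  \<open>- y\<close> it gives the other, because \<open>g\<close> is odd along
  \<open>y\<close>.\<close>

lemma superlinear_add_eq:
  assumes g: "superlinear_on UNIV g" and y: "g (\<lambda>i. - y i) = - g y"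
  shows "g (\<lambda>i. x i + y i) = g x + g y"
proof -
  have "g (\<lambda>i. x i + y i) + g (\<lambda>i. - y i) \<le> g (\<lambda>i. (x i + y i) + - y i)"
    by (rule superlinear_on_add(2)[OF g]) auto
  then show ?thesis
    using superlinear_on_add(2)[OF g, of x y] y by simp
qed

text \<open>Superadditivity forces \<open>h y + h (- y) \<le> 0\<close>, while \<open>g\<close>
  bounds both summands from below by numbers with sum \<open>0\<close>. Hence directions in which a
  function is linear survive when it is enlarged.\<close>

lemma superlinear_le_imp_eq:
  assumes "superlinear_on UNIV h" "\<And>x. g x \<le> h x" "g (\<lambda>i. - y i) = - g y"
  shows "h y = g y" "h (\<lambda>i. - y i) = - h y"
proof -
  have "h y + h (\<lambda>i. - y i) \<le> 0"
    using superlinear_on_add(2)[OF assms(1), of y "\<lambda>i. - y i"] superlinear_0[OF assms(1)] by simp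
  then show "h y = g y" "h (\<lambda>i. - y i) = - h y"
    using assms(2)[of y] assms(2)[of "\<lambda>i. - y i"] assms(3) by linarith+
qed

text \<open>Directional derivatives are taken along the unit vectors one after another. Each makes
  the function odd in a new direction, and the earlier directions as well as the value at
  \<open>u\<close> persist by domination. A superlinear function that is odd along all unit vectors
  is linear.\<close>

lemma superlinear_dominated_linear:
  fixes g :: "('n::finite \<Rightarrow> int) \<Rightarrow> int"
  assumes g: "superlinear_on UNIV g" and u: "g (\<lambda>i. - u i) = - g u"
  obtains l :: "'n \<Rightarrow> int" where "g u = (\<Sum>i\<in>UNIV. l i * u i)"
    "\<And>x. g x \<le> (\<Sum>i\<in>UNIV. l i * x i)"
proof -
  define \<delta> where "\<delta> j = (\<lambda>i::'n. if i = j then 1 else 0 :: int)" for j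
  have "\<exists>h. superlinear_on UNIV h \<and> (\<forall>x. g x \<le> h x) \<and> (\<forall>j\<in>A. h (\<lambda>i. - \<delta> j i) = - h (\<delta> j))"
    for A :: "'n set"
    using finite[of A]
  proof (induction A rule: finite_induct)
    case empty
    then show ?case using g by auto
  next
    case (insert a A)
    then obtain h where h: "superlinear_on UNIV h" "\<And>x. g x \<le> h x"
      and hA: "\<And>j. j \<in> A \<Longrightarrow> h (\<lambda>i. - \<delta> j i) = - h (\<delta> j)" by auto
    obtain h' where h': "superlinear_on UNIV h'" "\<And>x. h x \<le> h' x"
      "h' (\<delta> a) = h (\<delta> a)" "h' (\<lambda>i. - \<delta> a i) = - h (\<delta> a)"
      using superlinear_linearize[OF h(1), of "\<delta> a"] by auto
    show ?case
    proof (intro exI conjI allI ballI)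
      show "g x \<le> h' x" for x using h(2)[of x] h'(2)[of x] by linarith
      show "h' (\<lambda>i. - \<delta> j i) = - h' (\<delta> j)" if "j \<in> insert a A" for j
        using that h'(3,4) superlinear_le_imp_eq(2)[OF h'(1,2) hA] by auto
    qed (rule h'(1))
  qed
  from this[of UNIV] obtain h where h: "superlinear_on UNIV h" "\<And>x. g x \<le> h x"
    and h\<delta>: "\<And>j. h (\<lambda>i. - \<delta> j i) = - h (\<delta> j)" by auto
  \<comment> \<open>Homogeneity covers the nonnegative factors; oddness along the unit vector covers
    the negative ones.\<close>
  have scale: "h (\<lambda>i. c * \<delta> j i) = c * h (\<delta> j)" for c j
  proof (cases "c \<ge> 0")
    case True
    then show ?thesis using superlinear_on_scale(2)[OF h(1), of "\<delta> j" "nat c"] by simp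
  next
    case False
    then show ?thesis
      using superlinear_on_scale(2)[OF h(1), of "\<lambda>i. - \<delta> j i" "nat (- c)"] h\<delta> by simp
  qed
  have lin: "h (\<lambda>i. x i + c * \<delta> j i) = h x + c * h (\<delta> j)" for x c j
    using superlinear_add_eq[OF h(1), of "\<lambda>i. c * \<delta> j i" x] scale[of c j] scale[of "-c" j] by simp
  have "h (\<lambda>i. if i \<in> A then x i else 0) = (\<Sum>i\<in>A. h (\<delta> i) * x i)" for x A
    using finite[of A]
  proof (induction A rule: finite_induct)
    case empty
    then show ?case using superlinear_0[OF h(1)] by simp
  next
    case (insert a A)
    have "(\<lambda>i. if i \<in> insert a A then x i else 0) = (\<lambda>i. (if i \<in> A then x i else 0) + x a * \<delta> a i)"
      using insert by (auto simp: \<delta>_def)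
    then have "h (\<lambda>i. if i \<in> insert a A then x i else 0)
        = h (\<lambda>i. if i \<in> A then x i else 0) + x a * h (\<delta> a)"
      using lin[of "\<lambda>i. if i \<in> A then x i else 0" "x a" a] by (rule trans[OF arg_cong[of _ _ h]])
    also have "\<dots> = (\<Sum>i\<in>insert a A. h (\<delta> i) * x i)"
      using insert by (simp only: insert.IH sum.insert[OF insert.hyps] mult.commute add.commute)
    finally show ?case .
  qed
  from this[of UNIV] have h_eq: "h x = (\<Sum>i\<in>UNIV. h (\<delta> i) * x i)" for x
    unfolding if_P[OF UNIV_I] .
  show ?thesis
  proof
    show "g u = (\<Sum>i\<in>UNIV. h (\<delta> i) * u i)"
      using h_eq[of u] superlinear_le_imp_eq(1)[OF h u] by (simp only:)
    show "g x \<le> (\<Sum>i\<in>UNIV. h (\<delta> i) * x i)" for x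
      using h(2)[of x] unfolding h_eq[of x] .
  qed
qed

text \<open>The function is restricted to the face spanned by the support of \<open>u\<close>. There
  \<open>u\<close> is an interior point, so the derivative at \<open>u\<close> is defined on the
  whole lattice and a linear form can be placed above it.\<close>

lemma superadditive_dominated_linear:
  fixes v :: "('n::finite \<Rightarrow> nat) \<Rightarrow> nat"
  assumes add: "\<And>a b. v a + v b \<le> v (\<lambda>i. a i + b i)"
    and scale: "\<And>k a. v (\<lambda>i. k * a i) = k * v a"
  obtains l :: "'n \<Rightarrow> nat" where "v u = (\<Sum>i\<in>UNIV. l i * u i)"
    "\<And>a. (\<And>i. u i = 0 \<Longrightarrow> a i = 0) \<Longrightarrow> v a \<le> (\<Sum>i\<in>UNIV. l i * a i)"
proof -
  define F where "F = {i. u i \<noteq> 0}"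
  \<comment> \<open>Only coordinates in the support of \<open>u\<close> are constrained. The others
    are free, so that large multiples of \<open>u\<close> absorb every integer vector.\<close>
  define C where "C = {x :: 'n \<Rightarrow> int. \<forall>i\<in>F. 0 \<le> x i}"
  \<comment> \<open>Projection to the face: coordinates outside the support are discarded, and on
    \<open>C\<close> the truncation by \<open>nat\<close> changes nothing on the support.\<close>
  define \<pi> where "\<pi> x = (\<lambda>i. if i \<in> F then nat (x i) else 0)" for x :: "'n \<Rightarrow> int"
  define g where "g x = int (v (\<pi> x))" for x
  have "superlinear_on C g"
    unfolding superlinear_on_def
  proof (intro conjI ballI allI)
    fix x y assume xy: "x \<in> C" "y \<in> C"
    then show "(\<lambda>i. x i + y i) \<in> C" by (auto simp: C_def)
    have "\<pi> (\<lambda>i. x i + y i) = (\<lambda>i. \<pi> x i + \<pi> y i)"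
      using xy by (auto simp: \<pi>_def C_def nat_add_distrib)
    then show "g x + g y \<le> g (\<lambda>i. x i + y i)"
      using add[of "\<pi> x" "\<pi> y"] by (simp add: g_def)
  next
    fix x :: "'n \<Rightarrow> int" and k :: nat assume x: "x \<in> C"
    then show "(\<lambda>i. int k * x i) \<in> C" by (auto simp: C_def)
    have "\<pi> (\<lambda>i. int k * x i) = (\<lambda>i. k * \<pi> x i)"
      by (auto simp: \<pi>_def nat_mult_distrib)
    then show "g (\<lambda>i. int k * x i) = int k * g x"
      using scale[of k "\<pi> x"] by (simp add: g_def)
  qed
  moreover have "(\<lambda>i. int (u i)) \<in> C" by (simp add: C_def)
  moreover have "\<forall>\<^sub>F k in sequentially. (\<lambda>i. int k * int (u i) + x i) \<in> C" for x
    unfolding eventually_sequentially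
  proof (intro exI allI impI)
    \<comment> \<open>This threshold works for all coordinates simultaneously because
      \<open>u i \<ge> 1\<close> on \<open>F\<close>.\<close>
    fix k assume k: "(\<Sum>i\<in>UNIV. nat \<bar>x i\<bar>) \<le> k"
    have "- x i \<le> int k * int (u i)" if "i \<in> F" for i
    proof -
      have "nat \<bar>x i\<bar> \<le> k" using k member_le_sum[of i UNIV "\<lambda>i. nat \<bar>x i\<bar>"] by simp
      then have "- x i \<le> int k * 1" by simp
      moreover have "int k * 1 \<le> int k * int (u i)"
        using that by (intro mult_left_mono) (auto simp: F_def)
      ultimately show ?thesis by linarith
    qed
    then show "(\<lambda>i. int k * int (u i) + x i) \<in> C" by (force simp: C_def)
  qed
  ultimately obtain h where h: "superlinear_on UNIV h" "\<And>x. x \<in> C \<Longrightarrow> g x \<le> h x"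
    "h (\<lambda>i. int (u i)) = g (\<lambda>i. int (u i))" "h (\<lambda>i. - int (u i)) = - g (\<lambda>i. int (u i))"
    by (rule superlinear_linearize) blast
  \<comment> \<open>The derivative at \<open>u\<close> is odd along \<open>u\<close>; this is what
    lets the dominating linear form keep the value at \<open>u\<close>.\<close>
  obtain l where l: "h (\<lambda>i. int (u i)) = (\<Sum>i\<in>UNIV. l i * int (u i))"
    "\<And>x. h x \<le> (\<Sum>i\<in>UNIV. l i * x i)"
    using superlinear_dominated_linear[OF h(1), of "\<lambda>i. int (u i)"] h(3,4) by auto
  \<comment> \<open>Unit vectors lie in \<open>C\<close>, where \<open>g\<close> takes natural
    values and is dominated by the form.\<close>
  have "0 \<le> l j" for j
  proof -
    have "(\<lambda>i. if i = j then 1 else 0) \<in> C" by (simp add: C_def)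
    from h(2)[OF this] have "0 \<le> h (\<lambda>i. if i = j then 1 else 0)"
      unfolding g_def by linarith
    also have "\<dots> \<le> (\<Sum>i\<in>UNIV. l i * (if i = j then 1 else 0))" by (rule l(2))
    finally show ?thesis by (simp add: if_distrib sum.delta cong: if_cong)
  qed
  then have lnat: "(\<Sum>i\<in>UNIV. l i * int (a i)) = int (\<Sum>i\<in>UNIV. nat (l i) * a i)" for a
    by simp
  have gint: "g (\<lambda>i. int (a i)) = int (v a)" if "\<And>i. u i = 0 \<Longrightarrow> a i = 0" for a
  proof -
    have "\<pi> (\<lambda>i. int (a i)) = a" using that by (auto simp: \<pi>_def F_def)
    then show ?thesis by (simp add: g_def)
  qed
  show ?thesis
  proof
    have "int (v u) = int (\<Sum>i\<in>UNIV. nat (l i) * u i)"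
      using l(1) h(3) gint[of u] unfolding lnat[of u] by simp
    then show "v u = (\<Sum>i\<in>UNIV. nat (l i) * u i)" by linarith
    fix a :: "'n \<Rightarrow> nat" assume a: "\<And>i. u i = 0 \<Longrightarrow> a i = 0"
    have "int (v a) \<le> h (\<lambda>i. int (a i))"
      using h(2)[of "\<lambda>i. int (a i)"] gint[OF a] by (auto simp: C_def)
    moreover have "h (\<lambda>i. int (a i)) \<le> int (\<Sum>i\<in>UNIV. nat (l i) * a i)"
      using l(2)[of "\<lambda>i. int (a i)"] unfolding lnat .
    ultimately show "v a \<le> (\<Sum>i\<in>UNIV. nat (l i) * a i)" by linarith
  qed
qed

subsection \<open>Ideals and symbolic powers\<close>

lemma ring_of_type_algebra_simps [simp]:
  "carrier ring_of_type_algebra = UNIV" "x \<otimes>\<^bsub>ring_of_type_algebra\<^esub> y = x * y"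
  "x \<oplus>\<^bsub>ring_of_type_algebra\<^esub> y = x + y" "\<one>\<^bsub>ring_of_type_algebra\<^esub> = 1"
  "\<zero>\<^bsub>ring_of_type_algebra\<^esub> = 0"
  by (simp_all add: ring_of_type_algebra_def)

lemma subset_ring_simps [simp]:
  "carrier (subset_ring A) = A" "x \<otimes>\<^bsub>subset_ring A\<^esub> y = x * y"
  "x \<oplus>\<^bsub>subset_ring A\<^esub> y = x + y" "\<one>\<^bsub>subset_ring A\<^esub> = 1"
  "\<zero>\<^bsub>subset_ring A\<^esub> = 0"
  by (simp_all add: subset_ring_def ring_of_type_algebra_def)

lemma subset_ring_UNIV: "subset_ring UNIV = ring_of_type_algebra"
  by (simp add: subset_ring_def ring_of_type_algebra_def)

lemma ring_subset_ring:
  assumes "1 \<in> A" "\<And>x y. x \<in> A \<Longrightarrow> y \<in> A \<Longrightarrow> x + y \<in> A" "\<And>x y. x \<in> A \<Longrightarrow> y \<in> A \<Longrightarrow> x * y \<in> A"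
    "\<And>x. x \<in> A \<Longrightarrow> - x \<in> A"
  shows "ring (subset_ring A)"
proof -
  have "0 \<in> A" using assms(2)[OF assms(1) assms(4)[OF assms(1)]] by simp
  moreover have "\<exists>y\<in>A. y + x = 0" if "x \<in> A" for x
    using assms(4)[OF that] by (intro bexI[of _ "- x"]) auto
  ultimately show ?thesis
    using assms(1-3) by (intro ringI abelian_groupI monoidI) (auto simp: algebra_simps)
qed

lemma ideal_subset_ring_iff:
  assumes "ring (subset_ring A)"
  shows "ideal I (subset_ring A) \<longleftrightarrow>
    I \<subseteq> A \<and> 0 \<in> I \<and> (\<forall>x\<in>I. \<forall>y\<in>I. x + y \<in> I) \<and> (\<forall>x\<in>I. \<forall>r\<in>A. r * x \<in> I)" (is "?L \<longleftrightarrow> ?R")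
proof
  assume ?L
  then interpret ideal I "subset_ring A" .
  show ?R
    using a_subset additive_subgroup.zero_closed[OF is_additive_subgroup]
      additive_subgroup.a_closed[OF is_additive_subgroup] I_l_closed
    by simp
next
  interpret ring "subset_ring A" by fact
  assume R: ?R
  have neg: "\<ominus>\<^bsub>subset_ring A\<^esub> x = - x" if "x \<in> A" for x
    using r_neg[of x] that by (simp add: eq_neg_iff_add_eq_0 add.commute)
  show ?L
  proof (rule idealI)
    show "ring (subset_ring A)" by fact
    show "subgroup I (add_monoid (subset_ring A))"
    proof (rule add.subgroupI)
      fix x assume x: "x \<in> I"
      then have xA: "x \<in> A" using R by auto
      have "- 1 \<in> A" using neg[of 1] a_inv_closed[of 1] one_closed by simp
      then have "- 1 * x \<in> I" using R x by blast
      then show "\<ominus>\<^bsub>subset_ring A\<^esub> x \<in> I" using neg[OF xA] by simp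
    qed (use R in auto)
  qed (use R in \<open>auto simp: mult.commute\<close>)
qed

lemma ideal_iff:
  fixes I :: "'a::comm_ring_1 set"
  shows
  "ideal I ring_of_type_algebra \<longleftrightarrow>
    0 \<in> I \<and> (\<forall>x\<in>I. \<forall>y\<in>I. x + y \<in> I) \<and> (\<forall>x\<in>I. \<forall>r. r * x \<in> I)"
  using ideal_subset_ring_iff[of UNIV I] by (simp add: subset_ring_UNIV ring_from_type_algebra)

lemma ideal_sum:
  fixes I :: "'a::comm_ring_1 set"
  shows
  "ideal I ring_of_type_algebra \<Longrightarrow> (\<And>x. x \<in> A \<Longrightarrow> f x \<in> I) \<Longrightarrow> sum f A \<in> I"
  by (induction A rule: infinite_finite_induct) (auto simp: ideal_iff)

lemma primeideal_iff:
  fixes I :: "'a::comm_ring_1 set"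
  shows
  "primeideal I ring_of_type_algebra \<longleftrightarrow>
    ideal I ring_of_type_algebra \<and> 1 \<notin> I \<and> (\<forall>x y. x * y \<in> I \<longrightarrow> x \<in> I \<or> y \<in> I)" (is "?L \<longleftrightarrow> ?R")
proof
  assume ?L
  then interpret primeideal I ring_of_type_algebra .
  show ?R using I_notcarr I_prime one_imp_carrier is_ideal by auto
next
  assume ?R
  then show ?L by (intro primeidealI cring_from_type_algebra) auto
qed

lemma genideal_subset_iff:
  "ideal I R \<Longrightarrow> genideal R A \<subseteq> I \<longleftrightarrow> A \<subseteq> I"
  by (auto simp: genideal_def)

lemma ideal_power_ideal: "ideal I ring_of_type_algebra \<Longrightarrow> ideal (ideal_power I n) ring_of_type_algebra"
proof (induction n)
  case 0
  then show ?case by (simp add: ideal_iff)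
next
  case (Suc n)
  then show ?case
    by (simp add: ring.ideal_prod_is_ideal[OF ring_from_type_algebra])
qed

lemma ideal_prod_mult: "x \<in> I \<Longrightarrow> y \<in> J \<Longrightarrow> x * y \<in> ideal_prod ring_of_type_algebra I J"
  using ideal_prod.prod[of x I y J ring_of_type_algebra] by simp

lemma ideal_prod_subset:
  fixes K :: "'a::comm_ring_1 set"
  assumes "ideal K ring_of_type_algebra" "\<And>x y. x \<in> I \<Longrightarrow> y \<in> J \<Longrightarrow> x * y \<in> K"
  shows "ideal_prod ring_of_type_algebra I J \<subseteq> K"
proof
  fix x assume "x \<in> ideal_prod ring_of_type_algebra I J"
  then show "x \<in> K"
    by (induction rule: ideal_prod.induct) (use assms in \<open>auto simp: ideal_iff\<close>)
qed

lemma ideal_power_mono: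
  assumes "I \<subseteq> J" shows "ideal_power I n \<subseteq> ideal_power J n"
proof (induction n)
  case (Suc n)
  have "x \<in> ideal_prod ring_of_type_algebra J (ideal_power J n)"
    if "x \<in> ideal_prod ring_of_type_algebra I (ideal_power I n)" for x
    using that
  proof (induction rule: ideal_prod.induct)
    case (prod i j)
    then show ?case using assms Suc by (intro ideal_prod.prod) auto
  next
    case (sum a b)
    then show ?case by (intro ideal_prod.sum)
  qed
  then show ?case by auto
qed simp

lemma ideal_power_Suc_subset:
  assumes "ideal I ring_of_type_algebra" shows "ideal_power I (Suc n) \<subseteq> ideal_power I n"
  using ideal_prod_subset[OF ideal_power_ideal[OF assms], of I "ideal_power I n"]
    ideal_power_ideal[OF assms, of n] by (simp add: ideal_iff)

lemma ideal_power_mult: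
  assumes I: "ideal I ring_of_type_algebra" and "x \<in> ideal_power I m" "y \<in> ideal_power I n"
  shows "x * y \<in> ideal_power I (m + n)"
  using assms(2)
proof (induction m arbitrary: x)
  case 0
  then show ?case using assms ideal_power_ideal[OF I, of n] by (simp add: ideal_iff)
next
  case (Suc m)
  have K: "ideal {x. x * y \<in> ideal_power I (Suc (m + n))} ring_of_type_algebra"
    using ideal_power_ideal[OF I, of "Suc (m + n)"]
    by (simp add: ideal_iff distrib_right mult.assoc del: ideal_power.simps)
  have "ideal_power I (Suc m) \<subseteq> {x. x * y \<in> ideal_power I (Suc (m + n))}"
    unfolding ideal_power.simps(2)[of I m]
    by (rule ideal_prod_subset[OF K]) (auto simp: mult.assoc intro!: ideal_prod_mult Suc.IH)
  then show ?case using Suc.prems by auto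
qed

section \<open>Localization and symbolic powers\<close>

text \<open>Common denominators show that fractions with numerator in \<open>I\<close> already form
  an ideal; excluding \<open>0\<close> from \<open>U\<close> makes the denominators genuine.\<close>

lemma extended_ideal_eq:
  fixes U :: "'a::idom set"
  assumes U: "1 \<in> U" "0 \<notin> U" "\<And>x y. x \<in> U \<Longrightarrow> y \<in> U \<Longrightarrow> x * y \<in> U"
    and I: "ideal I ring_of_type_algebra"
  shows "extended_ideal U I = {Fract r u | r u. r \<in> I \<and> u \<in> U}" (is "_ = ?E")
proof -
  have nz: "u \<noteq> 0" if "u \<in> U" for u using that U(2) by auto
  have ring: "ring (subset_ring (localization U))"
  proof (rule ring_subset_ring)
    show "1 \<in> localization U"
      unfolding localization_def using U(1) One_fract_def by blast
    fix x y assume "x \<in> localization U" "y \<in> localization U"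
    then obtain a u b w where x: "x = Fract a u" "u \<in> U" and y: "y = Fract b w" "w \<in> U"
      by (auto simp: localization_def)
    show "x + y \<in> localization U" "x * y \<in> localization U"
      using x y nz[of u] nz[of w] U(3)[of u w] by (auto simp: localization_def)
  next
    fix x assume "x \<in> localization U"
    then obtain a u where "x = Fract a u" "u \<in> U" by (auto simp: localization_def)
    then have "- x = Fract (- a) u" by simp
    with \<open>u \<in> U\<close> show "- x \<in> localization U" unfolding localization_def by blast
  qed
  have "ideal ?E (subset_ring (localization U))"
    unfolding ideal_subset_ring_iff[OF ring]
  proof (intro conjI ballI)
    show "?E \<subseteq> localization U" by (auto simp: localization_def)
    show "0 \<in> ?E" using I U(1) by (auto simp: ideal_iff Zero_fract_def)
    fix x assume "x \<in> ?E"
    then obtain a u where x: "x = Fract a u" "a \<in> I" "u \<in> U" by auto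
    {
      fix y assume "y \<in> ?E"
      then obtain b w where y: "y = Fract b w" "b \<in> I" "w \<in> U" by auto
      have "a * w + b * u \<in> I" using x y I unfolding ideal_iff by (simp add: mult.commute)
      then show "x + y \<in> ?E" using x y nz[of u] nz[of w] U(3)[of u w] by auto
    }
    fix r assume "r \<in> localization U"
    then obtain b w where r: "r = Fract b w" "w \<in> U" by (auto simp: localization_def)
    have "b * a \<in> I" using x I unfolding ideal_iff by simp
    then show "r * x \<in> ?E" using x r U(3)[of w u] by auto
  qed
  moreover have "to_fract ` I \<subseteq> ?E" using U(1) by (auto simp: to_fract_def)
  ultimately have "extended_ideal U I \<subseteq> ?E"
    unfolding extended_ideal_def by (subst genideal_subset_iff)
  moreover have "Fract r u \<in> extended_ideal U I" if "r \<in> I" "u \<in> U" for r u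
    unfolding extended_ideal_def genideal_def
  proof (rule InterI, clarify)
    fix K assume K: "ideal K (subset_ring (localization U))" "to_fract ` I \<subseteq> K"
    have "Fract 1 u \<in> localization U" using that by (auto simp: localization_def)
    then have "Fract 1 u * to_fract r \<in> K"
      using K that unfolding ideal_subset_ring_iff[OF ring] by blast
    then show "Fract r u \<in> K" by (simp add: to_fract_def)
  qed
  ultimately show ?thesis by blast
qed

text \<open>In a domain \<open>f/1 = r/u\<close> means \<open>u f = r\<close>, so denominators can
  be cleared. The existence of a minimal prime excludes \<open>0\<close> as a denominator.\<close>

lemma mem_symbolic_power_iff:
  fixes I :: "'a::idom set"
  assumes I: "ideal I ring_of_type_algebra" and ne: "minimal_primes I \<noteq> {}"
  shows "f \<in> symbolic_power I n \<longleftrightarrow> (\<exists>s. s \<notin> \<Union>(minimal_primes I) \<and> s * f \<in> ideal_power I n)"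
proof -
  define U where "U = - \<Union>(minimal_primes I)"
  have prime: "primeideal Q ring_of_type_algebra" if "Q \<in> minimal_primes I" for Q
    using that by (simp add: minimal_primes_def)
  have U: "1 \<in> U" "0 \<notin> U"
    using ne prime unfolding U_def primeideal_iff ideal_iff by auto
  have U3: "x * y \<in> U" if "x \<in> U" "y \<in> U" for x y
  proof -
    have "x * y \<notin> Q" if "Q \<in> minimal_primes I" for Q
      using that \<open>x \<in> U\<close> \<open>y \<in> U\<close> prime[OF that] unfolding U_def primeideal_iff by blast
    then show ?thesis by (simp add: U_def)
  qed
  have nz: "u \<noteq> 0" if "u \<in> U" for u using that U(2) by auto
  have "f \<in> symbolic_power I n \<longleftrightarrow> (\<exists>r u. r \<in> ideal_power I n \<and> u \<in> U \<and> Fract f 1 = Fract r u)"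
    using extended_ideal_eq[OF U U3 ideal_power_ideal[OF I]]
    unfolding symbolic_power_def U_def[symmetric] by (auto simp: to_fract_def)
  also have "\<dots> \<longleftrightarrow> (\<exists>u. u \<in> U \<and> u * f \<in> ideal_power I n)"
  proof safe
    fix r u assume "r \<in> ideal_power I n" "u \<in> U" "Fract f 1 = Fract r u"
    then have "u * f = r" using nz[of u] by (simp add: eq_fract mult.commute)
    then show "\<exists>u. u \<in> U \<and> u * f \<in> ideal_power I n" using \<open>u \<in> U\<close> \<open>r \<in> _\<close> by blast
  next
    fix u assume u: "u \<in> U" "u * f \<in> ideal_power I n"
    have "Fract f 1 = Fract (u * f) u" using nz[OF u(1)] by (simp add: eq_fract mult.commute)
    then show "\<exists>r u. r \<in> ideal_power I n \<and> u \<in> U \<and> Fract f 1 = Fract r u" using u by blast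
  qed
  finally show ?thesis by (simp add: U_def)
qed

lemma minimal_primes_primeideal:
  assumes "primeideal P ring_of_type_algebra"
  shows "minimal_primes P = {P}"
  using assms by (auto simp: minimal_primes_def)

lemma mem_symbolic_power_primeideal_iff:
  fixes P :: "'a::idom set"
  assumes "primeideal P ring_of_type_algebra"
  shows "f \<in> symbolic_power P n \<longleftrightarrow> (\<exists>s. s \<notin> P \<and> s * f \<in> ideal_power P n)"
  using mem_symbolic_power_iff[of P f n] assms
  by (simp add: minimal_primes_primeideal primeideal_iff)

context
  fixes P :: "'a::idom set"
  assumes P: "primeideal P ring_of_type_algebra"
begin

lemma symbolic_power_ideal: "ideal (symbolic_power P n) ring_of_type_algebra"
  unfolding ideal_iff
proof (intro conjI ballI allI)
  have 1: "1 \<notin> P" and pr: "\<And>x y. x * y \<in> P \<Longrightarrow> x \<in> P \<or> y \<in> P"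
    and Pn: "0 \<in> ideal_power P n" "\<And>x y. x \<in> ideal_power P n \<Longrightarrow> y \<in> ideal_power P n \<Longrightarrow> x + y \<in> ideal_power P n"
      "\<And>x r. x \<in> ideal_power P n \<Longrightarrow> r * x \<in> ideal_power P n"
    using P ideal_power_ideal[of P n] unfolding primeideal_iff ideal_iff by blast+
  note iff = mem_symbolic_power_primeideal_iff[OF P, of _ n]
  show "0 \<in> symbolic_power P n" using 1 Pn(1) by (auto simp: iff)
  fix x assume "x \<in> symbolic_power P n"
  then obtain s where s: "s \<notin> P" "s * x \<in> ideal_power P n" by (auto simp: iff)
  {
    fix y assume "y \<in> symbolic_power P n"
    then obtain t where t: "t \<notin> P" "t * y \<in> ideal_power P n" by (auto simp: iff)
    have "(s * t) * (x + y) = t * (s * x) + s * (t * y)" by (simp add: algebra_simps)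
    then have "(s * t) * (x + y) \<in> ideal_power P n" using Pn s t by simp
    moreover have "s * t \<notin> P" using pr s t by blast
    ultimately show "x + y \<in> symbolic_power P n" unfolding iff by blast
  }
  fix r
  have "s * (r * x) = r * (s * x)" by (simp add: algebra_simps)
  then have "s * (r * x) \<in> ideal_power P n" using Pn(3)[OF s(2)] by metis
  then show "r * x \<in> symbolic_power P n" using s(1) unfolding iff by blast
qed

lemma symbolic_power_mult:
  assumes "x \<in> symbolic_power P m" "y \<in> symbolic_power P n"
  shows "x * y \<in> symbolic_power P (m + n)"
proof -
  have I: "ideal P ring_of_type_algebra" using P unfolding primeideal_iff by blast
  obtain s t where st: "s \<notin> P" "s * x \<in> ideal_power P m" "t \<notin> P" "t * y \<in> ideal_power P n"
    using assms unfolding mem_symbolic_power_primeideal_iff[OF P] by blast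
  have "(s * t) * (x * y) = (s * x) * (t * y)" by (simp add: algebra_simps)
  then have "(s * t) * (x * y) \<in> ideal_power P (m + n)"
    using ideal_power_mult[OF I st(2,4)] by (simp only:)
  moreover have "s * t \<notin> P" using P st(1,3) unfolding primeideal_iff by blast
  ultimately show ?thesis unfolding mem_symbolic_power_primeideal_iff[OF P] by blast
qed

lemma symbolic_power_0: "symbolic_power P 0 = UNIV"
proof -
  have "1 \<notin> P" using P by (simp add: primeideal_iff)
  then show ?thesis by (auto simp: mem_symbolic_power_primeideal_iff[OF P])
qed

lemma symbolic_power_Suc_subset: "symbolic_power P (Suc n) \<subseteq> symbolic_power P n"
proof
  fix f assume "f \<in> symbolic_power P (Suc n)"
  then obtain s where "s \<notin> P" "s * f \<in> ideal_power P (Suc n)"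
    by (auto simp: mem_symbolic_power_primeideal_iff[OF P] simp del: ideal_power.simps)
  moreover have "ideal P ring_of_type_algebra" using P unfolding primeideal_iff by blast
  ultimately have "s \<notin> P \<and> s * f \<in> ideal_power P n"
    using ideal_power_Suc_subset[of P n] by (simp only: subset_iff) blast
  then show "f \<in> symbolic_power P n"
    unfolding mem_symbolic_power_primeideal_iff[OF P] ..
qed

lemma subset_symbolic_power_1: "P \<subseteq> symbolic_power P 1"
proof
  fix f assume "f \<in> P"
  then have "1 * f \<in> ideal_power P 1"
    using ideal_prod_mult[of f P 1 UNIV] by simp
  moreover have "1 \<notin> P" using P unfolding primeideal_iff by blast
  ultimately have "1 \<notin> P \<and> 1 * f \<in> ideal_power P 1" by blast
  then show "f \<in> symbolic_power P 1"
    unfolding mem_symbolic_power_primeideal_iff[OF P] ..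
qed

end

subsection \<open>Polynomials\<close>

abbreviation lookup :: "('a \<Rightarrow>\<^sub>0 'b::zero) \<Rightarrow> 'a \<Rightarrow> 'b" where
  "lookup \<equiv> Poly_Mapping.lookup"

abbreviation keys :: "('a \<Rightarrow>\<^sub>0 'b::zero) \<Rightarrow> 'a set" where
  "keys \<equiv> Poly_Mapping.keys"

abbreviation single :: "'a \<Rightarrow> 'b \<Rightarrow> 'a \<Rightarrow>\<^sub>0 'b::zero" where
  "single \<equiv> Poly_Mapping.single"

lemma poly_mapping_expansion:
  "finite S \<Longrightarrow> keys f \<subseteq> S \<Longrightarrow> (\<Sum>m\<in>S. single m (lookup f m)) = f"
  by (rule poly_mapping_eqI) (auto simp: lookup_sum lookup_single when_def in_keys_iff)

lemma lookup_mult_sum: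
  fixes f g :: "'a::comm_monoid_add \<Rightarrow>\<^sub>0 'b::comm_semiring_1"
  shows "lookup (f * g) k =
    (\<Sum>a\<in>keys f. \<Sum>b\<in>keys g. if a + b = k then lookup f a * lookup g b else 0)"
proof -
  have "f * g = (\<Sum>a\<in>keys f. single a (lookup f a)) *
      (\<Sum>b\<in>keys g. single b (lookup g b))"
    by (simp add: poly_mapping_expansion)
  also have "\<dots> = (\<Sum>a\<in>keys f. \<Sum>b\<in>keys g.
      single (a + b) (lookup f a * lookup g b))"
    by (simp add: sum_product mult_single)
  finally show ?thesis
    by (simp only: lookup_sum lookup_single when_def)
qed

text \<open>Only one term of the convolution can survive. This is used for shifts by a monomial,
  constant terms, extreme Taylor coefficients and leading terms.\<close>

lemma lookup_mult_unique:
  fixes f g :: "'a::comm_monoid_add \<Rightarrow>\<^sub>0 'b::comm_semiring_1"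
  assumes "\<And>a' b'. a' \<in> keys f \<Longrightarrow> b' \<in> keys g \<Longrightarrow> a' + b' = a + b \<Longrightarrow> a' = a \<and> b' = b"
  shows "lookup (f * g) (a + b) = lookup f a * lookup g b"
proof -
  have "lookup (f * g) (a + b) = (\<Sum>a'\<in>keys f. \<Sum>b'\<in>keys g.
      if a' = a then (if b' = b then lookup f a * lookup g b else 0) else 0)"
    unfolding lookup_mult_sum by (intro sum.cong refl) (use assms in auto)
  also have "\<dots> = (\<Sum>a'\<in>keys f. if a' = a then
      (\<Sum>b'\<in>keys g. if b' = b then lookup f a * lookup g b else 0) else 0)"
    by (intro sum.cong) auto
  also have "\<dots> = lookup f a * lookup g b"
    by (auto simp: in_keys_iff)
  finally show ?thesis .
qed

lemma lookup_single_mult: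
  fixes f :: "'a::cancel_comm_monoid_add \<Rightarrow>\<^sub>0 'b::comm_semiring_1"
  shows "lookup (single m c * f) (m + k) = c * lookup f k"
proof -
  have "lookup (single m c * f) (m + k) = lookup (single m c) m * lookup f k"
    by (rule lookup_mult_unique) (simp split: if_splits)
  then show ?thesis by simp
qed

lemma lookup_const_mult:
  fixes f :: "'a::cancel_comm_monoid_add \<Rightarrow>\<^sub>0 'b::comm_semiring_1"
  shows "lookup (single 0 c * f) k = c * lookup f k"
  using lookup_single_mult[of 0 c f k] by simp

lemma lookup_mult_0:
  fixes f g :: "'n monomial \<Rightarrow>\<^sub>0 'b::comm_semiring_1"
  shows "lookup (f * g) 0 = lookup f 0 * lookup g 0"
proof -
  have zero: "a = 0 \<and> b = 0" if "a + b = 0 + 0" for a b :: "'n monomial"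
  proof -
    have "lookup a i + lookup b i = 0" for i
      using arg_cong[OF that, of "\<lambda>f. lookup f i"] by (simp add: lookup_add)
    then show ?thesis by (simp add: poly_mapping_eq_iff fun_eq_iff)
  qed
  have "lookup (f * g) (0 + 0) = lookup f 0 * lookup g 0"
    by (rule lookup_mult_unique) (rule zero)
  then show ?thesis by simp
qed

lemma keys_mult_subset:
  fixes f g :: "'a::comm_monoid_add \<Rightarrow>\<^sub>0 'b::comm_semiring_1"
  assumes "k \<in> keys (f * g)"
  obtains a b where "a \<in> keys f" "b \<in> keys g" "k = a + b"
proof -
  have "k \<in> {a + b | a b. a \<in> keys f \<and> b \<in> keys g}" using assms keys_mult[of f g] by (rule subsetD[rotated])
  then show ?thesis using that by auto
qed

lemma lookup_mult_mem_ideal: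
  fixes f g :: "'n monomial \<Rightarrow>\<^sub>0 'b::comm_ring_1"
  assumes "ideal P ring_of_type_algebra" "\<And>a b. a + b = k \<Longrightarrow> lookup f a * lookup g b \<in> P"
  shows "lookup (f * g) k \<in> P"
proof -
  have "0 \<in> P" using assms(1) by (simp add: ideal_iff)
  then show ?thesis
    unfolding lookup_mult_sum by (intro ideal_sum assms(1)) (simp add: assms(2))
qed

section \<open>Evaluation homomorphisms\<close>

text \<open>The images of whole monomials are prescribed instead of those of variables, so that both
  the Taylor expansion and the map setting some variables to zero are instances.\<close>

definition poly_eval :: "('k \<Rightarrow> 'b) \<Rightarrow> ('m \<Rightarrow> 'b) \<Rightarrow> ('m \<Rightarrow>\<^sub>0 'k::zero) \<Rightarrow> 'b::comm_ring_1" where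
  "poly_eval \<iota> E f = (\<Sum>m\<in>keys f. \<iota> (lookup f m) * E m)"

locale poly_evaluation =
  fixes \<iota> :: "'k::comm_ring_1 \<Rightarrow> 'b::comm_ring_1" and E :: "'m::comm_monoid_add \<Rightarrow> 'b"
  assumes coeff_add: "\<iota> (x + y) = \<iota> x + \<iota> y" and coeff_mult: "\<iota> (x * y) = \<iota> x * \<iota> y"
    and mon_add: "E (m + m') = E m * E m'"
begin

lemma coeff_0: "\<iota> 0 = 0"
  using coeff_add[of 0 0] by simp

lemma poly_eval_superset:
  "finite S \<Longrightarrow> keys f \<subseteq> S \<Longrightarrow> poly_eval \<iota> E f = (\<Sum>m\<in>S. \<iota> (lookup f m) * E m)"
  unfolding poly_eval_def
  by (rule sum.mono_neutral_left) (auto simp: in_keys_iff coeff_0)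

lemma poly_eval_single: "poly_eval \<iota> E (single m c) = \<iota> c * E m"
  by (subst poly_eval_superset[of "{m}"]) auto

lemma poly_eval_0: "poly_eval \<iota> E 0 = 0"
  by (simp add: poly_eval_def)

lemma poly_eval_add: "poly_eval \<iota> E (f + g) = poly_eval \<iota> E f + poly_eval \<iota> E g"
proof -
  define S where "S = keys f \<union> keys g"
  have "finite S" "keys f \<subseteq> S" "keys g \<subseteq> S" "keys (f + g) \<subseteq> S"
    using keys_add[of f g] by (auto simp: S_def)
  then show ?thesis
    by (simp add: poly_eval_superset lookup_add coeff_add distrib_right sum.distrib)
qed

lemma poly_eval_sum: "poly_eval \<iota> E (sum f A) = (\<Sum>i\<in>A. poly_eval \<iota> E (f i))"
  by (induction A rule: infinite_finite_induct) (auto simp: poly_eval_add poly_eval_0)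

lemma poly_eval_mult: "poly_eval \<iota> E (f * g) = poly_eval \<iota> E f * poly_eval \<iota> E g"
proof -
  have "f * g = (\<Sum>a\<in>keys f. single a (lookup f a)) *
      (\<Sum>b\<in>keys g. single b (lookup g b))"
    by (simp add: poly_mapping_expansion)
  also have "\<dots> = (\<Sum>a\<in>keys f. \<Sum>b\<in>keys g.
      single (a + b) (lookup f a * lookup g b))"
    by (simp add: sum_product mult_single)
  also have "poly_eval \<iota> E \<dots> = (\<Sum>a\<in>keys f. \<Sum>b\<in>keys g.
      (\<iota> (lookup f a) * E a) * (\<iota> (lookup g b) * E b))"
    by (simp add: poly_eval_sum poly_eval_single coeff_mult mon_add mult_ac)
  also have "\<dots> = poly_eval \<iota> E f * poly_eval \<iota> E g"
    by (simp add: poly_eval_def sum_product)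
  finally show ?thesis .
qed

end

subsection \<open>Taylor expansion\<close>

definition restrict_monomial :: "'n set \<Rightarrow> 'n monomial \<Rightarrow> 'n monomial" where
  "restrict_monomial A m = Poly_Mapping.Abs_poly_mapping (\<lambda>i. if i \<in> A then lookup m i else 0)"

lemma lookup_restrict_monomial [simp]:
  "lookup (restrict_monomial A m) i = (if i \<in> A then lookup m i else 0)"
proof -
  have "finite {i. (if i \<in> A then lookup m i else 0) \<noteq> 0}"
    by (rule finite_subset[OF _ finite_keys[of m]]) (auto simp: in_keys_iff)
  then show ?thesis by (simp add: restrict_monomial_def)
qed

lemma restrict_monomial_add: "restrict_monomial A (m + m') = restrict_monomial A m + restrict_monomial A m'"
  by (rule poly_mapping_eqI) (simp add: lookup_add)

lemma restrict_monomial_Compl: "restrict_monomial A m + restrict_monomial (- A) m = m"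
  by (rule poly_mapping_eqI) (simp add: lookup_add)

text \<open>
  The properties of the Taylor expansion of the monomial \<open>m\<close> under \<open>x\<^sub>i \<mapsto> x\<^sub>i + y\<^sub>i\<close>,
  \<open>i \<in> A\<close>, in \<open>R[y]\<close> that survive multiplication.
\<close>
definition taylor_like :: "'n set \<Rightarrow> 'n monomial \<Rightarrow> ('n monomial \<Rightarrow>\<^sub>0 ('n, 'k::comm_ring_1) mpoly) \<Rightarrow> bool" where
  "taylor_like A m F \<longleftrightarrow>
     (\<forall>a\<in>keys F. (\<forall>i. i \<notin> A \<longrightarrow> lookup a i = 0) \<and>
        (\<forall>k\<in>keys (lookup F a). a + k = m)) \<and>
     lookup F (restrict_monomial A m) = single (restrict_monomial (- A) m) 1 \<and>
     lookup F 0 = single m 1"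

text \<open>A nonzero coefficient at \<open>y^a\<close> forces \<open>a\<close> to divide
  \<open>m\<close>, and \<open>a\<close> is supported in \<open>A\<close>.\<close>

lemma taylor_like_le:
  assumes "taylor_like A m F" "a \<in> keys F"
  shows "lookup a i \<le> lookup (restrict_monomial A m) i"
proof -
  have "lookup F a \<noteq> 0" using assms(2) by (simp add: in_keys_iff)
  then obtain k where "k \<in> keys (lookup F a)" by (metis all_not_in_conv keys_eq_empty)
  then have "a + k = m" "i \<notin> A \<longrightarrow> lookup a i = 0"
    using assms unfolding taylor_like_def by blast+
  then show ?thesis by (auto simp: lookup_add)
qed

text \<open>The \<open>y\<close>-exponents of each factor are bounded by the \<open>A\<close>-part
  of its monomial, so the extreme exponent of the product comes from a single pair. Its coefficient
  is a product of two monic monomials, and no binomial coefficient has to be computed.\<close>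

lemma taylor_like_mult:
  fixes F G :: "'n monomial \<Rightarrow>\<^sub>0 ('n, 'k::comm_ring_1) mpoly"
  assumes F: "taylor_like A m F" and G: "taylor_like A m' G"
  shows "taylor_like A (m + m') (F * G)"
  unfolding taylor_like_def
proof (intro conjI ballI)
  fix a assume a: "a \<in> keys (F * G)"
  then obtain b c where bc: "b \<in> keys F" "c \<in> keys G" "a = b + c"
    by (rule keys_mult_subset)
  show "\<forall>i. i \<notin> A \<longrightarrow> lookup a i = 0"
    using bc F G by (auto simp: taylor_like_def lookup_add)
  fix k assume k: "k \<in> keys (lookup (F * G) a)"
  have "\<exists>b\<in>keys F. \<exists>c\<in>keys G. b + c = a \<and>
      k \<in> keys (lookup F b * lookup G c)"
  proof (rule ccontr)
    assume neg: "\<not> ?thesis"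
    have "lookup (lookup (F * G) a) k = 0"
      unfolding lookup_mult_sum[of F G] lookup_sum
      by (intro sum.neutral ballI) (use neg in \<open>auto simp: in_keys_iff\<close>)
    with k show False by (simp add: in_keys_iff)
  qed
  then obtain b c where bc: "b \<in> keys F" "c \<in> keys G" "b + c = a"
    and k: "k \<in> keys (lookup F b * lookup G c)" by blast
  from k obtain k1 k2 where "k1 \<in> keys (lookup F b)" "k2 \<in> keys (lookup G c)" "k = k1 + k2"
    by (rule keys_mult_subset)
  moreover have "b + k1 = m" "c + k2 = m'" using calculation bc F G by (auto simp: taylor_like_def)
  ultimately show "a + k = m + m'" using bc by (auto simp: add_ac)
next
  have "lookup (F * G) (restrict_monomial A m + restrict_monomial A m') =
      lookup F (restrict_monomial A m) * lookup G (restrict_monomial A m')"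
  proof (rule lookup_mult_unique)
    fix a b assume ab: "a \<in> keys F" "b \<in> keys G"
      "a + b = restrict_monomial A m + restrict_monomial A m'"
    have "lookup a i = lookup (restrict_monomial A m) i \<and> lookup b i = lookup (restrict_monomial A m') i" for i
      using taylor_like_le[OF F ab(1), of i] taylor_like_le[OF G ab(2), of i]
        arg_cong[OF ab(3), of "\<lambda>f. lookup f i"] unfolding lookup_add by linarith
    then show "a = restrict_monomial A m \<and> b = restrict_monomial A m'"
      by (auto intro: poly_mapping_eqI)
  qed
  then show "lookup (F * G) (restrict_monomial A (m + m')) =
      single (restrict_monomial (- A) (m + m')) 1"
    using F G by (simp add: taylor_like_def restrict_monomial_add mult_single)
next
  show "lookup (F * G) 0 = single (m + m') 1"
    using F G by (simp add: taylor_like_def lookup_mult_0 mult_single)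
qed

lemma taylor_like_1: "taylor_like A 0 1"
proof -
  have "restrict_monomial A 0 = 0" for A :: "'a set"
    by (rule poly_mapping_eqI) simp
  then show ?thesis by (simp add: taylor_like_def)
qed

lemma taylor_like_power: "taylor_like A (single i 1) F \<Longrightarrow> taylor_like A (single i k) (F ^ k)"
proof (induction k)
  case (Suc k)
  have "single i (Suc k) = single i 1 + single i k"
    by (simp add: single_add[symmetric])
  then show ?case using taylor_like_mult[OF Suc.prems Suc.IH[OF Suc.prems]] by simp
qed (simp add: taylor_like_1)

lemma taylor_like_prod:
  "finite S \<Longrightarrow> (\<And>i. i \<in> S \<Longrightarrow> taylor_like A (m i) (F i)) \<Longrightarrow> taylor_like A (\<Sum>i\<in>S. m i) (\<Prod>i\<in>S. F i)"
  by (induction S rule: finite_induct) (auto simp: taylor_like_1 taylor_like_mult)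

abbreviation var :: "'n \<Rightarrow> ('n, 'k::comm_ring_1) mpoly" where
  "var i \<equiv> single (single i 1) 1"

definition shifted_var :: "'n set \<Rightarrow> 'n \<Rightarrow> 'n monomial \<Rightarrow>\<^sub>0 ('n, 'k::comm_ring_1) mpoly" where
  "shifted_var A i = single 0 (var i) +
     (if i \<in> A then single (single i 1) 1 else 0)"

lemma single_1_neq_0 [simp]: "single i (1::nat) \<noteq> 0"
  by (metis lookup_single_eq lookup_zero one_neq_zero)

lemma taylor_like_shifted_var: "taylor_like A (single i 1) (shifted_var A i)"
proof (cases "i \<in> A")
  case True
  have "restrict_monomial A (single i 1) = single i 1"
    "restrict_monomial (- A) (single i (1::nat)) = 0"
    using True by (auto intro!: poly_mapping_eqI simp: lookup_single when_def)
  moreover have a_cases: "a = 0 \<or> a = single i 1"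
    if "a \<in> keys (shifted_var A i :: 'a monomial \<Rightarrow>\<^sub>0 ('a, 'b) mpoly)" for a
  proof (rule ccontr)
    assume "\<not> ?thesis"
    then have "lookup (shifted_var A i :: 'a monomial \<Rightarrow>\<^sub>0 ('a, 'b) mpoly) a = 0"
      by (auto simp: shifted_var_def lookup_add lookup_single when_def)
    with that show False by (simp add: in_keys_iff)
  qed
  moreover have vals: "lookup (shifted_var A i) 0 = (var i :: ('a, 'b) mpoly)"
    "lookup (shifted_var A i) (single i 1) = (1 :: ('a, 'b) mpoly)"
    using True single_1_neq_0[of i, symmetric] by (auto simp: shifted_var_def lookup_add lookup_single when_def)
  moreover have "(\<forall>j. j \<notin> A \<longrightarrow> lookup a j = 0) \<and>
      (\<forall>k\<in>keys (lookup (shifted_var A i) a :: ('a, 'b) mpoly). a + k = single i 1)"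
    if "a \<in> keys (shifted_var A i :: 'a monomial \<Rightarrow>\<^sub>0 ('a, 'b) mpoly)" for a
    using a_cases[OF that]
  proof
    assume a: "a = 0"
    show ?thesis unfolding a vals by simp
  next
    assume a: "a = single i 1"
    show ?thesis unfolding a vals using True by (auto simp: lookup_single when_def)
  qed
  ultimately show ?thesis
    unfolding taylor_like_def by simp
next
  case False
  have "restrict_monomial (- A) (single i 1) = single i 1"
    "restrict_monomial A (single i (1::nat)) = 0"
    using False by (auto intro!: poly_mapping_eqI simp: lookup_single when_def)
  then show ?thesis
    using False by (auto simp: taylor_like_def shifted_var_def split: if_splits)
qed

definition taylor_monomial :: "'n::finite set \<Rightarrow> 'n monomial \<Rightarrow> 'n monomial \<Rightarrow>\<^sub>0 ('n, 'k::comm_ring_1) mpoly" where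
  "taylor_monomial A m = (\<Prod>i\<in>UNIV. shifted_var A i ^ lookup m i)"

lemma taylor_like_taylor_monomial:
  fixes m :: "'n::finite monomial"
  shows "taylor_like A m (taylor_monomial A m :: 'n monomial \<Rightarrow>\<^sub>0 ('n, 'k::comm_ring_1) mpoly)"
proof -
  have "taylor_like A (\<Sum>i\<in>UNIV. single i (lookup m i))
      (\<Prod>i\<in>UNIV. shifted_var A i ^ lookup m i :: 'n monomial \<Rightarrow>\<^sub>0 ('n, 'k) mpoly)"
    by (intro taylor_like_prod taylor_like_power taylor_like_shifted_var) simp
  then show ?thesis by (simp add: taylor_monomial_def poly_mapping_expansion)
qed

text \<open>The coefficient at \<open>y^a\<close> is the Hasse (divided) derivative of
  \<open>f\<close> of multi-order \<open>a\<close> when \<open>a\<close> is supported in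
  \<open>A\<close>, and zero otherwise.\<close>

definition taylor :: "'n::finite set \<Rightarrow> ('n, 'k::comm_ring_1) mpoly \<Rightarrow> 'n monomial \<Rightarrow>\<^sub>0 ('n, 'k) mpoly" where
  "taylor A = poly_eval (\<lambda>c. single 0 (single 0 c)) (taylor_monomial A)"

interpretation taylor: poly_evaluation
  "\<lambda>c::'k::comm_ring_1. single 0 (single 0 c)"
  "taylor_monomial A :: 'n::finite monomial \<Rightarrow> 'n monomial \<Rightarrow>\<^sub>0 ('n, 'k) mpoly" for A
  by standard (simp_all add: single_add mult_single taylor_monomial_def lookup_add power_add prod.distrib)

lemma taylor_add: "taylor A (f + g) = taylor A f + taylor A g"
  and taylor_mult: "taylor A (f * g) = taylor A f * taylor A g"
  by (simp_all add: taylor_def taylor.poly_eval_add taylor.poly_eval_mult)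

lemma lookup_taylor:
  "lookup (lookup (taylor A f) a) k =
     (\<Sum>m\<in>keys f. lookup f m * lookup (lookup (taylor_monomial A m) a) k)"
  by (simp add: taylor_def poly_eval_def lookup_sum lookup_const_mult)

lemma lookup_taylor_0:
  fixes f :: "('n::finite, 'k::comm_ring_1) mpoly"
  shows "lookup (taylor A f) 0 = f"
proof -
  have "lookup (taylor A f) 0 = (\<Sum>m\<in>keys f. single 0 (lookup f m) * single m 1)"
    using taylor_like_taylor_monomial[of A, where ?'k = 'k]
    by (simp add: taylor_def poly_eval_def lookup_sum lookup_const_mult taylor_like_def)
  also have "\<dots> = f" by (simp add: mult_single poly_mapping_expansion)
  finally show ?thesis .
qed

text \<open>A monomial \<open>x^m\<close> contributes to the coefficient at \<open>y^a\<close> only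
  a multiple of \<open>x^(m-a)\<close>; differentiation thus translates exponents, which is
  compatible with a monomial order.\<close>

lemma keys_lookup_taylor:
  fixes f :: "('n::finite, 'k::comm_ring_1) mpoly"
  assumes "k \<in> keys (lookup (taylor A f) a)"
  shows "a + k \<in> keys f"
proof (rule ccontr)
  assume "a + k \<notin> keys f"
  have "lookup (lookup (taylor_monomial A m :: 'n monomial \<Rightarrow>\<^sub>0 ('n, 'k) mpoly) a) k = 0"
    if m: "m \<in> keys f" for m
  proof (rule ccontr)
    assume "lookup (lookup (taylor_monomial A m :: 'n monomial \<Rightarrow>\<^sub>0 ('n, 'k) mpoly) a) k \<noteq> 0"
    then have "a + k = m"
      using taylor_like_taylor_monomial[of A m, where ?'k = 'k]
      unfolding taylor_like_def by (metis in_keys_iff lookup_zero)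
    with m \<open>a + k \<notin> _\<close> show False by simp
  qed
  then have "lookup (lookup (taylor A f) a) k = 0" by (simp add: lookup_taylor)
  with assms show False by (simp add: in_keys_iff)
qed

text \<open>Since exponents are translated, only \<open>m\<close> itself contributes to this
  position, and it does so with factor \<open>1\<close>. Hence nothing can vanish modulo the
  characteristic.\<close>

lemma restrict_mem_keys_lookup_taylor:
  fixes f :: "('n::finite, 'k::comm_ring_1) mpoly"
  assumes m: "m \<in> keys f"
  shows "restrict_monomial (- A) m \<in> keys (lookup (taylor A f) (restrict_monomial A m))"
proof -
  let ?a = "restrict_monomial A m" and ?k = "restrict_monomial (- A) m"
  let ?t = "\<lambda>m'. lookup (lookup (taylor_monomial A m' :: 'n monomial \<Rightarrow>\<^sub>0 ('n, 'k) mpoly) ?a) ?k"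
  have "?t m' = (if m' = m then 1 else 0)" for m'
  proof (cases "m' = m")
    case True
    then show ?thesis using taylor_like_taylor_monomial[of A m, where ?'k = 'k] by (simp add: taylor_like_def)
  next
    case False
    have "?t m' = 0"
    proof (rule ccontr)
      assume "?t m' \<noteq> 0"
      then have "?a + ?k = m'"
        using taylor_like_taylor_monomial[of A m', where ?'k = 'k]
        unfolding taylor_like_def by (metis in_keys_iff lookup_zero)
      with False show False by (simp add: restrict_monomial_Compl)
    qed
    with False show ?thesis by simp
  qed
  then have "lookup (lookup (taylor A f) ?a) ?k = (\<Sum>m'\<in>keys f. lookup f m' * (if m' = m then 1 else 0))"
    by (simp only: lookup_taylor)
  then have "lookup (lookup (taylor A f) ?a) ?k = lookup f m"
    using m by (simp add: if_distrib cong: if_cong)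
  then show ?thesis using m by (simp add: in_keys_iff)
qed

section \<open>Hasse derivatives of symbolic powers\<close>

text \<open>For an ideal \<open>P\<close> of \<open>R\<close> this is the ideal
  \<open>P R[y] + (y)^n\<close> of \<open>R[y]\<close>.\<close>

definition vanishing_order :: "('n::finite, 'k::comm_ring_1) mpoly set \<Rightarrow> nat \<Rightarrow> ('n monomial \<Rightarrow>\<^sub>0 ('n, 'k) mpoly) set" where
  "vanishing_order P n = {F. \<forall>a. monomial_degree a < n \<longrightarrow> lookup F a \<in> P}"

lemma monomial_degree_add: "monomial_degree (a + b) = monomial_degree a + monomial_degree b"
  by (simp add: monomial_degree_def lookup_add sum.distrib)

lemma monomial_degree_eq_0_iff: "monomial_degree a = 0 \<longleftrightarrow> a = 0"
  by (auto simp: monomial_degree_def intro: poly_mapping_eqI)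

context
  fixes P :: "('n::finite, 'k::comm_ring_1) mpoly set"
  assumes P: "ideal P ring_of_type_algebra"
begin

lemma vanishing_order_add: "F \<in> vanishing_order P n \<Longrightarrow> G \<in> vanishing_order P n \<Longrightarrow> F + G \<in> vanishing_order P n"
  using P by (auto simp: vanishing_order_def lookup_add ideal_iff)

lemma vanishing_order_times: "G \<in> vanishing_order P n \<Longrightarrow> F * G \<in> vanishing_order P n"
  using P by (auto simp: vanishing_order_def ideal_iff monomial_degree_add intro!: lookup_mult_mem_ideal[OF P])

text \<open>In a product of coefficients of total degree at most \<open>n\<close>, either the
  exponent from \<open>F\<close> is zero, and that coefficient lies in \<open>P\<close>, or the
  exponent from \<open>G\<close> has degree less than \<open>n\<close>.\<close>

lemma vanishing_order_mult:
  assumes F: "lookup F 0 \<in> P" and G: "G \<in> vanishing_order P n"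
  shows "F * G \<in> vanishing_order P (Suc n)"
  unfolding vanishing_order_def
proof (safe intro!: lookup_mult_mem_ideal[OF P])
  fix a b :: "'n monomial" assume ab: "monomial_degree (a + b) < Suc n"
  show "lookup F a * lookup G b \<in> P"
  proof (cases "a = 0")
    case True
    then show ?thesis using F P unfolding ideal_iff by (metis mult.commute)
  next
    case False
    then have "monomial_degree b < n"
      using ab monomial_degree_eq_0_iff[of a] by (simp add: monomial_degree_add)
    then show ?thesis using G P by (auto simp: vanishing_order_def ideal_iff)
  qed
qed

text \<open>The constant term of the Taylor expansion of \<open>f\<close> is \<open>f\<close>, so
  each factor from \<open>P\<close> raises the order by one.\<close>

lemma taylor_ideal_power: "f \<in> ideal_power P n \<Longrightarrow> taylor A f \<in> vanishing_order P n"
proof (induction n arbitrary: f)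
  case 0
  then show ?case by (simp add: vanishing_order_def)
next
  case (Suc n)
  have "ideal {f. taylor A f \<in> vanishing_order P (Suc n)} ring_of_type_algebra"
    unfolding ideal_iff using P vanishing_order_add vanishing_order_times
    by (auto simp: taylor_add taylor_mult)
       (auto simp: taylor_def taylor.poly_eval_0 vanishing_order_def ideal_iff)
  then have "ideal_power P (Suc n) \<subseteq> {f. taylor A f \<in> vanishing_order P (Suc n)}"
    unfolding ideal_power.simps
    by (rule ideal_prod_subset)
       (auto simp: taylor_mult lookup_taylor_0 intro!: vanishing_order_mult Suc.IH)
  then show ?case using Suc.prems by blast
qed

end

text \<open>Induction on the degree of \<open>a\<close>: the coefficient of \<open>F * G\<close> at
  \<open>a\<close> is \<open>lookup F 0 * lookup G a\<close> plus products with coefficients of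
  \<open>G\<close> of smaller degree, which are already in \<open>P\<close>. Primality then removes
  the constant term of \<open>F\<close>.\<close>

lemma vanishing_order_cancel:
  fixes P :: "('n::finite, 'k::comm_ring_1) mpoly set"
  assumes P: "primeideal P ring_of_type_algebra" and F: "lookup F 0 \<notin> P"
    and FG: "F * G \<in> vanishing_order P n"
  shows "G \<in> vanishing_order P n"
proof -
  have I: "ideal P ring_of_type_algebra" and sub: "\<And>x y. x + y \<in> P \<Longrightarrow> y \<in> P \<Longrightarrow> x \<in> P"
  proof -
    show I: "ideal P ring_of_type_algebra" using P by (simp add: primeideal_iff)
    fix x y assume "x + y \<in> P" "y \<in> P"
    then have "(x + y) + - 1 * y \<in> P" using I unfolding ideal_iff by blast
    then show "x \<in> P" by simp
  qed
  define F' where "F' = F - single 0 (lookup F 0)"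
  have "lookup G a \<in> P" if "monomial_degree a < n" for a
    using that
  proof (induction "monomial_degree a" arbitrary: a rule: less_induct)
    case less
    have "lookup (F' * G) a \<in> P"
    proof (rule lookup_mult_mem_ideal[OF I])
      fix b c assume bc: "b + c = a"
      show "lookup F' b * lookup G c \<in> P"
      proof (cases "b = 0")
        case True
        then show ?thesis using I by (simp add: F'_def lookup_minus ideal_iff)
      next
        case False
        then have "monomial_degree c < monomial_degree a"
          using bc monomial_degree_eq_0_iff[of b] by (auto simp: monomial_degree_add)
        then have "lookup G c \<in> P" using less by auto
        then show ?thesis using I by (auto simp: ideal_iff)
      qed
    qed
    moreover have "lookup (F * G) a = lookup F 0 * lookup G a + lookup (F' * G) a"
      by (simp add: F'_def left_diff_distrib lookup_minus lookup_const_mult)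
    moreover have "lookup (F * G) a \<in> P" using FG less.prems by (simp add: vanishing_order_def)
    ultimately have "lookup F 0 * lookup G a \<in> P" using sub by metis
    then show ?case using P F by (auto simp: primeideal_iff)
  qed
  then show ?thesis by (simp add: vanishing_order_def)
qed

text \<open>Some \<open>s\<close> outside \<open>P\<close> multiplies \<open>f\<close> into the
  ordinary power, where the order of vanishing is known. The expansion of \<open>s\<close> has
  constant term \<open>s\<close>, so it can be cancelled.\<close>

lemma lookup_taylor_symbolic_power:
  fixes P :: "('n::{finite,linorder}, 'k::field) mpoly set"
  assumes P: "primeideal P ring_of_type_algebra" and f: "f \<in> symbolic_power P n"
    and a: "monomial_degree a < n"
  shows "lookup (taylor A f) a \<in> P"
proof -
  obtain s where s: "s \<notin> P" "s * f \<in> ideal_power P n"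
    using f unfolding mem_symbolic_power_primeideal_iff[OF P] by blast
  have "taylor A s * taylor A f \<in> vanishing_order P n"
    using taylor_ideal_power[of P "s * f" n A] s(2) P by (simp add: primeideal_iff taylor_mult)
  then have "taylor A f \<in> vanishing_order P n"
    by (rule vanishing_order_cancel[OF P, rotated]) (simp add: lookup_taylor_0 s)
  then show ?thesis using a by (simp add: vanishing_order_def)
qed

subsection \<open>Monomial ideals\<close>

definition monomial_of :: "('n::finite \<Rightarrow> nat) \<Rightarrow> 'n monomial" where
  "monomial_of f = Poly_Mapping.Abs_poly_mapping f"

lemma lookup_monomial_of [simp]: "lookup (monomial_of f) = f"
  by (simp add: monomial_of_def)

lemma monomial_of_lookup [simp]: "monomial_of (lookup m) = m"
  by (rule poly_mapping_eqI) simp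

lemma single_power: "single w (1::'k::comm_semiring_1) ^ k = single (monomial_of (\<lambda>i. k * lookup w i)) 1"
proof (induction k)
  case 0
  have 0: "monomial_of (\<lambda>i. 0) = 0" by (rule poly_mapping_eqI) simp
  show ?case by (simp add: 0)
next
  case (Suc k)
  have "w + monomial_of (\<lambda>i. k * lookup w i) = monomial_of (\<lambda>i. Suc k * lookup w i)"
    by (rule poly_mapping_eqI) (simp add: lookup_add)
  then show ?case using Suc by (simp only: power_Suc mult_single mult_1_right)
qed

lemma monomial_le_add:
  fixes m w :: "'n::finite monomial"
  assumes "\<And>i. lookup m i \<le> lookup w i"
  obtains k where "w = k + m"
proof
  show "w = monomial_of (\<lambda>i. lookup w i - lookup m i) + m"
    by (rule poly_mapping_eqI) (use assms in \<open>simp add: lookup_add\<close>)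
qed

lemma monomial_split_var:
  fixes m :: "'n::finite monomial"
  assumes "lookup m i \<noteq> 0"
  obtains m' where "m = m' + single i 1"
proof (rule monomial_le_add)
  show "lookup (single i 1) j \<le> lookup m j" for j
    using assms by (auto simp: lookup_single when_def)
qed (rule that)

definition up_closed :: "'n monomial set \<Rightarrow> bool" where
  "up_closed L \<longleftrightarrow> (\<forall>m\<in>L. \<forall>k. k + m \<in> L)"

definition monomial_ideal :: "'n monomial set \<Rightarrow> ('n, 'k::comm_ring_1) mpoly set" where
  "monomial_ideal L = {f. keys f \<subseteq> L}"

lemma single_mem_monomial_ideal_iff [simp]:
  "single m (1::'k::comm_ring_1) \<in> monomial_ideal L \<longleftrightarrow> m \<in> L"
  by (simp add: monomial_ideal_def)

lemma monomial_ideal_mult: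
  assumes "f \<in> monomial_ideal L" "g \<in> monomial_ideal L'" "\<And>a b. a \<in> L \<Longrightarrow> b \<in> L' \<Longrightarrow> a + b \<in> L''"
  shows "f * g \<in> monomial_ideal L''"
  unfolding monomial_ideal_def
proof (intro CollectI subsetI)
  fix k assume "k \<in> keys (f * g)"
  then obtain a b where "a \<in> keys f" "b \<in> keys g" "k = a + b" by (rule keys_mult_subset)
  then show "k \<in> L''" using assms by (auto simp: monomial_ideal_def)
qed

lemma monomial_ideal_ideal:
  fixes L :: "'n monomial set"
  assumes "up_closed L"
  shows "ideal (monomial_ideal L :: ('n, 'k::comm_ring_1) mpoly set) ring_of_type_algebra"
  unfolding ideal_iff
proof (intro conjI ballI allI)
  show "0 \<in> (monomial_ideal L :: ('n, 'k) mpoly set)" by (simp add: monomial_ideal_def)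
next
  fix f g :: "('n, 'k) mpoly" assume "f \<in> monomial_ideal L" "g \<in> monomial_ideal L"
  then show "f + g \<in> monomial_ideal L" using keys_add[of f g] by (auto simp: monomial_ideal_def)
next
  fix f r :: "('n, 'k) mpoly" assume "f \<in> monomial_ideal L"
  then show "r * f \<in> monomial_ideal L"
    by (rule monomial_ideal_mult[of r UNIV, rotated])
       (use assms in \<open>auto simp: monomial_ideal_def up_closed_def\<close>)
qed

lemma mem_ideal_if_monomials:
  fixes f :: "('n, 'k::comm_ring_1) mpoly"
  assumes I: "ideal I ring_of_type_algebra" and f: "\<And>m. m \<in> keys f \<Longrightarrow> single m 1 \<in> I"
  shows "f \<in> I"
proof -
  have "single 0 (lookup f m) * single m 1 \<in> I" if "m \<in> keys f" for m
    using f[OF that] I unfolding ideal_iff by blast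
  then have "single m (lookup f m) \<in> I" if "m \<in> keys f" for m
    using that by (simp add: mult_single)
  then have "(\<Sum>m\<in>keys f. single m (lookup f m)) \<in> I"
    by (rule ideal_sum[OF I])
  then show ?thesis by (simp add: poly_mapping_expansion)
qed

lemma genideal_monomials:
  fixes L :: "'n monomial set"
  assumes "up_closed L"
  shows "genideal ring_of_type_algebra {single m 1 | m. m \<in> L} = (monomial_ideal L :: ('n, 'k::comm_ring_1) mpoly set)"
proof
  show "genideal ring_of_type_algebra {single m 1 | m. m \<in> L} \<subseteq> (monomial_ideal L :: ('n, 'k) mpoly set)"
    by (subst genideal_subset_iff[OF monomial_ideal_ideal[OF assms]]) auto
  show "(monomial_ideal L :: ('n, 'k) mpoly set) \<subseteq> genideal ring_of_type_algebra {single m 1 | m. m \<in> L}"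
    unfolding genideal_def
  proof (intro subsetI InterI)
    fix f :: "('n, 'k) mpoly" and I :: "('n, 'k) mpoly set"
    assume f: "f \<in> monomial_ideal L" and "I \<in> {I. ideal I ring_of_type_algebra \<and> {single m 1 | m. m \<in> L} \<subseteq> I}"
    then have "ideal I ring_of_type_algebra" and I: "{single m 1 | m. m \<in> L} \<subseteq> I" by auto
    from this(1) show "f \<in> I"
      by (rule mem_ideal_if_monomials) (use f I in \<open>auto simp: monomial_ideal_def\<close>)
  qed
qed

section \<open>Leading monomials and initial ideals\<close>

definition leading_monomials ::
  "('n monomial \<Rightarrow> 'n monomial \<Rightarrow> bool) \<Rightarrow> ('n, 'k::zero) mpoly set \<Rightarrow> 'n monomial set" where
  "leading_monomials ord I = {m. \<exists>f\<in>I. is_leading_monomial ord f m}"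

context
  fixes ord :: "'n monomial \<Rightarrow> 'n monomial \<Rightarrow> bool"
  assumes ord: "monomial_order ord"
begin

lemma ord_antisym: "ord a b \<Longrightarrow> ord b a \<Longrightarrow> a = b"
  using ord unfolding monomial_order_def by (blast dest: antisympD)

lemma ord_trans: "ord a b \<Longrightarrow> ord b c \<Longrightarrow> ord a c"
  using ord unfolding monomial_order_def by (blast dest: transpD)

lemma ord_total: "ord a b \<or> ord b a"
  using ord unfolding monomial_order_def by (metis reflpD totalpD)

lemma ord_add: "ord a b \<Longrightarrow> ord (a + c) (b + c)"
  using ord unfolding monomial_order_def by blast

lemma ord_zero: "ord 0 a"
  using ord unfolding monomial_order_def by blast

lemma ord_add_cancel: "ord (a + b) (a + c) \<Longrightarrow> ord b c"
  using ord_total[of b c] ord_add[of c b a] ord_antisym[of "a + b" "a + c"]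
  by (auto simp: add.commute)

lemma ord_add_mono: "ord a a' \<Longrightarrow> ord b b' \<Longrightarrow> ord (a + b) (a' + b')"
  using ord_add[of a a' b] ord_add[of b b' a'] ord_trans by (simp add: add.commute)

text \<open>Increasing either summand strictly would increase the sum strictly. This isolates the
  leading term of a product.\<close>

lemma ord_add_eq:
  assumes "ord a a'" "ord b b'" "a + b = a' + b'"
  shows "a = a' \<and> b = b'"
proof -
  have "ord (a + b) (a' + b)" "ord (a' + b) (a' + b')"
    using assms ord_add[of a a' b] ord_add[of b b' a'] by (auto simp: add.commute)
  then have "a' + b = a' + b'" using assms(3) ord_antisym by metis
  then show ?thesis using assms(3) by simp
qed

lemma is_leading_monomial_mult:
  fixes f g :: "('n, 'k::idom) mpoly"
  assumes f: "is_leading_monomial ord f a" and g: "is_leading_monomial ord g b"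
  shows "is_leading_monomial ord (f * g) (a + b)"
  unfolding is_leading_monomial_def
proof
  have "lookup (f * g) (a + b) = lookup f a * lookup g b"
    by (rule lookup_mult_unique, rule ord_add_eq) (use f g in \<open>auto simp: is_leading_monomial_def\<close>)
  then show "a + b \<in> keys (f * g)" using f g by (simp add: is_leading_monomial_def in_keys_iff)
  show "\<forall>m'\<in>keys (f * g). ord m' (a + b)"
  proof
    fix m' assume "m' \<in> keys (f * g)"
    then obtain c d where "c \<in> keys f" "d \<in> keys g" "m' = c + d" by (rule keys_mult_subset)
    then show "ord m' (a + b)" using f g ord_add_mono by (auto simp: is_leading_monomial_def)
  qed
qed

lemma leading_monomials_mult:
  fixes I J K :: "('n, 'k::idom) mpoly set"
  assumes "a \<in> leading_monomials ord I" "b \<in> leading_monomials ord J"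
    and "\<And>f g. f \<in> I \<Longrightarrow> g \<in> J \<Longrightarrow> f * g \<in> K"
  shows "a + b \<in> leading_monomials ord K"
  using assms is_leading_monomial_mult unfolding leading_monomials_def by blast

lemma is_leading_monomial_single: "is_leading_monomial ord (single m (1::'k::zero_neq_one)) m"
  using ord_total[of m m] by (simp add: is_leading_monomial_def)

lemma up_closed_leading_monomials:
  fixes I :: "('n, 'k::idom) mpoly set"
  assumes "ideal I ring_of_type_algebra"
  shows "up_closed (leading_monomials ord I)"
  unfolding up_closed_def
proof (intro ballI allI)
  fix m k assume "m \<in> leading_monomials ord I"
  moreover have "k \<in> leading_monomials ord {single k (1::'k)}"
    using is_leading_monomial_single by (auto simp: leading_monomials_def)
  ultimately show "k + m \<in> leading_monomials ord I"
    using assms by (auto intro!: leading_monomials_mult[of k "{single k 1}" m I I] simp: ideal_iff)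
qed

text \<open>The leading monomials of an ideal are already closed under multiplication by monomials,
  so generating an ideal from them adds no new monomial.\<close>

lemma initial_ideal_eq:
  fixes I :: "('n, 'k::field) mpoly set"
  assumes "ideal I ring_of_type_algebra"
  shows "initial_ideal ord I = monomial_ideal (leading_monomials ord I)"
  using genideal_monomials[OF up_closed_leading_monomials[OF assms], where ?'k = 'k]
  by (simp add: initial_ideal_def leading_monomials_def)

text \<open>As \<open>0\<close> is the least exponent, a polynomial with this leading monomial is a
  nonzero constant and hence a unit.\<close>

lemma zero_notin_leading_monomials:
  fixes I :: "('n, 'k::field) mpoly set"
  assumes I: "ideal I ring_of_type_algebra" and 1: "1 \<notin> I"
  shows "0 \<notin> leading_monomials ord I"
proof
  assume "0 \<in> leading_monomials ord I"
  then obtain f where f: "f \<in> I" "is_leading_monomial ord f 0" by (auto simp: leading_monomials_def)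
  have k: "keys f = {0}"
    using f(2) ord_antisym[OF ord_zero] unfolding is_leading_monomial_def by blast
  then have "f = single 0 (lookup f 0)"
    by (intro poly_mapping_eqI) (auto simp: lookup_single when_def in_keys_iff set_eq_iff)
  moreover have "lookup f 0 \<noteq> 0" using k by (simp flip: in_keys_iff)
  ultimately have "single 0 (inverse (lookup f 0)) * f = 1"
    by (metis left_inverse mult_single single_one add_0)
  then show False using f(1) I 1 unfolding ideal_iff by metis
qed

end

section \<open>Minimal primes of monomial ideals\<close>

definition var_ideal :: "'n set \<Rightarrow> ('n, 'k::comm_ring_1) mpoly set" where
  "var_ideal A = monomial_ideal {m. \<exists>i\<in>A. lookup m i \<noteq> 0}"

lemma var_mem_var_ideal_iff [simp]: "(var i :: ('n, 'k::comm_ring_1) mpoly) \<in> var_ideal A \<longleftrightarrow> i \<in> A"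
  by (auto simp: var_ideal_def lookup_single when_def)

lemma var_ideal_mono: "A \<subseteq> B \<Longrightarrow> var_ideal A \<subseteq> var_ideal B"
  by (fastforce simp: var_ideal_def monomial_ideal_def)

text \<open>The ideal is the kernel of the evaluation that sets the variables in \<open>A\<close> to
  zero, with values in a domain.\<close>

lemma var_ideal_primeideal:
  "primeideal (var_ideal A :: ('n::{finite,linorder}, 'k::field) mpoly set) ring_of_type_algebra"
proof -
  define E where "E m = (if \<exists>i\<in>A. lookup m i \<noteq> 0 then 0 else single m 1 :: ('n, 'k) mpoly)" for m
  interpret ev: poly_evaluation "\<lambda>c::'k. single 0 c" E
    by standard (auto simp: single_add mult_single E_def lookup_add)
  let ?ev = "poly_eval (\<lambda>c::'k. single 0 c) E"
  have lookup_ev: "lookup (?ev f) k = (if \<exists>i\<in>A. lookup k i \<noteq> 0 then 0 else lookup f k)" for f k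
  proof -
    have "lookup (?ev f) k = (\<Sum>m\<in>keys f. if m = k then (if \<exists>i\<in>A. lookup k i \<noteq> 0 then 0 else lookup f k) else 0)"
      unfolding poly_eval_def lookup_sum lookup_const_mult
      by (intro sum.cong) (auto simp: E_def lookup_single when_def)
    then show ?thesis by (simp add: in_keys_iff)
  qed
  have ker: "f \<in> var_ideal A \<longleftrightarrow> ?ev f = 0" for f
    by (auto simp: var_ideal_def monomial_ideal_def poly_mapping_eq_iff fun_eq_iff lookup_ev in_keys_iff subset_iff)
  show ?thesis
    unfolding primeideal_iff
  proof (intro conjI allI impI)
    show "ideal (var_ideal A :: ('n, 'k) mpoly set) ring_of_type_algebra"
      unfolding var_ideal_def
      by (rule monomial_ideal_ideal) (auto simp: up_closed_def lookup_add)
    show "(1 :: ('n, 'k) mpoly) \<notin> var_ideal A"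
      by (simp add: var_ideal_def monomial_ideal_def)
    fix x y :: "('n, 'k) mpoly" assume "x * y \<in> var_ideal A"
    then show "x \<in> var_ideal A \<or> y \<in> var_ideal A"
      unfolding ker ev.poly_eval_mult by simp
  qed
qed

text \<open>A vertex cover of the supports. Such covers correspond to the primes generated by
  variables that contain the monomial ideal.\<close>

definition transversal :: "'n monomial set \<Rightarrow> 'n set \<Rightarrow> bool" where
  "transversal L A \<longleftrightarrow> (\<forall>m\<in>L. \<exists>i\<in>A. lookup m i \<noteq> 0)"

definition minimal_transversal :: "'n monomial set \<Rightarrow> 'n set \<Rightarrow> bool" where
  "minimal_transversal L A \<longleftrightarrow> transversal L A \<and> (\<forall>B\<subset>A. \<not> transversal L B)"

lemma minimal_transversal_exists:
  fixes A :: "'n::finite set"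
  assumes "transversal L A"
  obtains B where "B \<subseteq> A" "minimal_transversal L B"
proof -
  have "\<exists>B\<subseteq>A. minimal_transversal L B"
    using finite[of A] assms
  proof (induction A rule: finite_psubset_induct)
    case (psubset A)
    show ?case
    proof (cases "minimal_transversal L A")
      case False
      then obtain B where "B \<subset> A" "transversal L B"
        using psubset.prems unfolding minimal_transversal_def by blast
      then show ?thesis using psubset.IH[of B] by blast
    qed blast
  qed
  then show ?thesis using that by blast
qed

lemma transversal_UNIV: "0 \<notin> L \<Longrightarrow> transversal L UNIV"
  unfolding transversal_def by (metis UNIV_I lookup_zero poly_mapping_eqI)

lemma monomial_ideal_subset_var_ideal_iff:
  "(monomial_ideal L :: ('n, 'k::comm_ring_1) mpoly set) \<subseteq> var_ideal A \<longleftrightarrow> transversal L A"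
proof
  assume sub: "(monomial_ideal L :: ('n, 'k) mpoly set) \<subseteq> var_ideal A"
  have "(single m 1 :: ('n, 'k) mpoly) \<in> var_ideal A" if "m \<in> L" for m
    using that sub by (auto simp: subset_iff)
  then show "transversal L A" by (simp add: transversal_def var_ideal_def)
qed (auto simp: transversal_def var_ideal_def monomial_ideal_def)

text \<open>Variables are split off one at a time, and primality puts one of them into
  \<open>Q\<close>.\<close>

lemma primeideal_single_mem:
  fixes Q :: "('n::finite, 'k::comm_ring_1) mpoly set"
  assumes Q: "primeideal Q ring_of_type_algebra" and m: "single m 1 \<in> Q"
  shows "\<exists>i. lookup m i \<noteq> 0 \<and> var i \<in> Q"
  using m
proof (induction "monomial_degree m" arbitrary: m)
  case 0
  then have "m = 0" by (simp add: monomial_degree_eq_0_iff)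
  then show ?case using 0 Q by (simp add: primeideal_iff)
next
  case (Suc n)
  then have "m \<noteq> 0" using monomial_degree_eq_0_iff[of m] by linarith
  then obtain i where i: "lookup m i \<noteq> 0" by (metis lookup_zero poly_mapping_eqI)
  then obtain m' where m': "m = m' + single i 1"
    by (metis monomial_split_var)
  have "monomial_degree (single i (1::nat)) = 1"
    by (simp add: monomial_degree_def lookup_single when_def)
  then have "n = monomial_degree m'" using Suc(2) m' by (simp add: monomial_degree_add)
  have "single m' 1 * (var i :: ('n, 'k) mpoly) \<in> Q" using Suc(3) m' by (simp add: mult_single)
  then have "single m' 1 \<in> Q \<or> (var i :: ('n, 'k) mpoly) \<in> Q" using Q unfolding primeideal_iff by blast
  then show ?case
  proof
    assume "single m' 1 \<in> Q"
    then obtain j where "lookup m' j \<noteq> 0 \<and> var j \<in> Q"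
      using Suc(1)[OF \<open>n = _\<close>] by blast
    then show ?thesis using m' by (auto simp: lookup_add)
  qed (use i in blast)
qed

lemma var_ideal_subset:
  fixes Q :: "('n::finite, 'k::comm_ring_1) mpoly set"
  assumes Q: "ideal Q ring_of_type_algebra" and A: "\<And>i. i \<in> A \<Longrightarrow> var i \<in> Q"
  shows "var_ideal A \<subseteq> Q"
proof
  fix f :: "('n, 'k) mpoly" assume f: "f \<in> var_ideal A"
  show "f \<in> Q"
  proof (rule mem_ideal_if_monomials[OF Q])
    fix m assume "m \<in> keys f"
    then obtain i where i: "i \<in> A" "lookup m i \<noteq> 0"
      using f by (auto simp: var_ideal_def monomial_ideal_def)
    then obtain m' where "m = m' + single i 1"
      by (metis monomial_split_var)
    then have "single m 1 = single m' 1 * (var i :: ('n, 'k) mpoly)" by (simp add: mult_single)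
    then show "single m 1 \<in> Q" using A[OF i(1)] Q unfolding ideal_iff by simp
  qed
qed

text \<open>The variables contained in a prime \<open>Q\<close> above the ideal form a transversal,
  and the prime they generate lies between the ideal and \<open>Q\<close>. So minimality among
  primes reduces to minimality among transversals.\<close>

lemma minimal_primes_monomial_ideal:
  fixes L :: "'n::{finite,linorder} monomial set"
  shows "minimal_primes (monomial_ideal L :: ('n, 'k::field) mpoly set) = var_ideal ` {A. minimal_transversal L A}"
proof -
  define V where "V Q = {i. var i \<in> Q}" for Q :: "('n, 'k) mpoly set"
  have V: "transversal L (V Q)" "var_ideal (V Q) \<subseteq> Q"
    if "primeideal Q ring_of_type_algebra" "monomial_ideal L \<subseteq> Q" for Q :: "('n, 'k) mpoly set"
  proof -
    show "transversal L (V Q)"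
      unfolding transversal_def
    proof
      fix m assume "m \<in> L"
      then have "single m 1 \<in> Q"
        by (intro subsetD[OF that(2)]) simp
      from primeideal_single_mem[OF that(1) this]
      show "\<exists>i\<in>V Q. lookup m i \<noteq> 0" unfolding V_def by blast
    qed
    show "var_ideal (V Q) \<subseteq> Q"
      using that(1) unfolding primeideal_iff by (intro var_ideal_subset) (simp_all add: V_def)
  qed
  show ?thesis
  proof (intro equalityI subsetI)
    fix Q :: "('n, 'k) mpoly set" assume "Q \<in> minimal_primes (monomial_ideal L)"
    then have Q: "primeideal Q ring_of_type_algebra" "monomial_ideal L \<subseteq> Q"
      and min: "\<And>Q'. primeideal Q' ring_of_type_algebra \<Longrightarrow> monomial_ideal L \<subseteq> Q' \<Longrightarrow> Q' \<subseteq> Q \<Longrightarrow> Q' = Q"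
      unfolding minimal_primes_def by simp_all
    obtain B where B: "B \<subseteq> V Q" "minimal_transversal L B"
      using minimal_transversal_exists[OF V(1)[OF Q]] .
    have "var_ideal B \<subseteq> Q"
      using B(1) V(2)[OF Q] var_ideal_mono by blast
    moreover have "monomial_ideal L \<subseteq> (var_ideal B :: ('n, 'k) mpoly set)"
      using B(2) by (simp add: monomial_ideal_subset_var_ideal_iff minimal_transversal_def)
    ultimately have "var_ideal B = Q" by (intro min var_ideal_primeideal)
    then show "Q \<in> var_ideal ` {A. minimal_transversal L A}" using B(2) by blast
  next
    fix Q :: "('n, 'k) mpoly set" assume "Q \<in> var_ideal ` {A. minimal_transversal L A}"
    then obtain A where A: "Q = var_ideal A" "minimal_transversal L A" by blast
    have "Q' = Q" if Q': "primeideal Q' ring_of_type_algebra" "monomial_ideal L \<subseteq> Q'" "Q' \<subseteq> Q" for Q'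
    proof -
      have "V Q' \<subseteq> A"
      proof
        fix i assume "i \<in> V Q'"
        then have "var i \<in> Q" using Q'(3) unfolding V_def by (simp only: mem_Collect_eq subsetD)
        then show "i \<in> A" unfolding A(1) var_mem_var_ideal_iff .
      qed
      then have "V Q' = A" using V(1)[OF Q'(1,2)] A(2) unfolding minimal_transversal_def by blast
      then have "Q \<subseteq> Q'" using V(2)[OF Q'(1,2)] A(1) by simp
      with Q'(3) show ?thesis by (rule subset_antisym)
    qed
    moreover have "primeideal Q ring_of_type_algebra" unfolding A(1) by (rule var_ideal_primeideal)
    moreover have "monomial_ideal L \<subseteq> Q"
      using A(2) unfolding A(1) monomial_ideal_subset_var_ideal_iff minimal_transversal_def by (rule conjunct1)
    ultimately show "Q \<in> minimal_primes (monomial_ideal L)"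
      unfolding minimal_primes_def by simp
  qed
qed

section \<open>Symbolic powers of squarefree monomial ideals\<close>

definition degree_in :: "'n set \<Rightarrow> 'n monomial \<Rightarrow> nat" where
  "degree_in A m = (\<Sum>i\<in>A. lookup m i)"

lemma monomial_degree_restrict: "monomial_degree (restrict_monomial A m) = degree_in A m"
  by (simp add: monomial_degree_def degree_in_def sum.If_cases)

lemma mem_symbolic_power_monomial_ideal_iff:
  fixes L :: "'n::{finite,linorder} monomial set" and f :: "('n, 'k::field) mpoly"
  assumes L: "up_closed L" "0 \<notin> L"
  shows "f \<in> symbolic_power (monomial_ideal L) n \<longleftrightarrow>
    (\<exists>s. (\<forall>A. minimal_transversal L A \<longrightarrow> s \<notin> var_ideal A) \<and> s * f \<in> ideal_power (monomial_ideal L) n)"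
proof -
  have "minimal_primes (monomial_ideal L :: ('n, 'k) mpoly set) \<noteq> {}"
    using minimal_transversal_exists[OF transversal_UNIV[OF L(2)]]
    unfolding minimal_primes_monomial_ideal by blast
  from mem_symbolic_power_iff[OF monomial_ideal_ideal[OF L(1)] this]
  show ?thesis unfolding minimal_primes_monomial_ideal by simp
qed

text \<open>It suffices to localize at the single prime \<open>var_ideal A\<close>. If the degree
  were too small, the derivative of \<open>f\<close> by the \<open>A\<close>-part of
  \<open>m\<close> would lie in that prime, yet it contains the rest of \<open>m\<close>, a monomial
  free of variables from \<open>A\<close>.\<close>

lemma symbolic_power_monomial_ideal_degree_ge:
  fixes f :: "('n::{finite,linorder}, 'k::field) mpoly"
  assumes L: "up_closed L" "0 \<notin> L" and f: "f \<in> symbolic_power (monomial_ideal L) n"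
    and A: "minimal_transversal L A" and m: "m \<in> keys f"
  shows "n \<le> degree_in A m"
proof (rule ccontr)
  assume neg: "\<not> n \<le> degree_in A m"
  obtain s where s: "s \<notin> var_ideal A" "s * f \<in> ideal_power (monomial_ideal L) n"
    using f A unfolding mem_symbolic_power_monomial_ideal_iff[OF L] by blast
  have "(monomial_ideal L :: ('n, 'k) mpoly set) \<subseteq> var_ideal A"
    using A by (simp add: monomial_ideal_subset_var_ideal_iff minimal_transversal_def)
  then have "s * f \<in> ideal_power (var_ideal A) n" using s(2) ideal_power_mono by blast
  then have "f \<in> symbolic_power (var_ideal A) n"
    using s(1) unfolding mem_symbolic_power_primeideal_iff[OF var_ideal_primeideal] by blast
  then have "lookup (taylor A f) (restrict_monomial A m) \<in> var_ideal A"
    by (rule lookup_taylor_symbolic_power[OF var_ideal_primeideal])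
       (use neg in \<open>simp add: monomial_degree_restrict\<close>)
  then show False
    using restrict_mem_keys_lookup_taylor[OF m, of A] by (auto simp: var_ideal_def monomial_ideal_def)
qed

text \<open>Membership depends on the support alone and grows with it; this is the combinatorial
  form of radicality of a monomial ideal.\<close>

definition squarefree_monomials :: "'n monomial set \<Rightarrow> bool" where
  "squarefree_monomials L \<longleftrightarrow> (\<forall>m\<in>L. \<forall>w. keys m \<subseteq> keys w \<longrightarrow> w \<in> L)"

text \<open>With \<open>N\<close> the degree of \<open>m\<close>, every exponent of \<open>m\<close>
  is at most \<open>N\<close>. So \<open>m\<close> divides the \<open>N\<close>-th power of any
  monomial whose support contains that of \<open>m\<close>, and radicality applies.\<close>

lemma squarefree_monomialsI:
  fixes L :: "'n::finite monomial set"
  assumes "radical_ideal (monomial_ideal L :: ('n, 'k::comm_ring_1) mpoly set)" and L: "up_closed L"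
  shows "squarefree_monomials L"
  unfolding squarefree_monomials_def
proof (intro ballI allI impI)
  fix m w :: "'n monomial" assume m: "m \<in> L" "keys m \<subseteq> keys w"
  define N where "N = monomial_degree m"
  have "lookup m i \<le> lookup (monomial_of (\<lambda>i. N * lookup w i)) i" for i
  proof (cases "lookup m i = 0")
    case False
    then have "lookup w i \<noteq> 0" using m(2) by (auto simp: in_keys_iff subset_iff)
    moreover have "lookup m i \<le> N"
      unfolding N_def monomial_degree_def by (intro member_le_sum) auto
    ultimately show ?thesis by (cases "lookup w i") auto
  qed simp
  then obtain k where "monomial_of (\<lambda>i. N * lookup w i) = k + m" by (rule monomial_le_add)
  then have "monomial_of (\<lambda>i. N * lookup w i) \<in> L" using L m(1) by (simp add: up_closed_def)
  then have "(single w 1 :: ('n, 'k) mpoly) ^ N \<in> monomial_ideal L" by (simp add: single_power)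
  then have "(single w 1 :: ('n, 'k) mpoly) \<in> monomial_ideal L"
    using assms(1) unfolding radical_ideal_def by blast
  then show "w \<in> L" by simp
qed

text \<open>Being free of variables from \<open>A\<close>, this monomial is an admissible
  denominator at the prime \<open>var_ideal A\<close>.\<close>

definition cofactor_monomial :: "'n::finite set \<Rightarrow> nat \<Rightarrow> 'n monomial" where
  "cofactor_monomial A n = monomial_of (\<lambda>i. if i \<in> A then 0 else n)"

text \<open>Minimality of \<open>A\<close> yields, for \<open>i\<close> in \<open>A\<close>, a
  member of \<open>L\<close> involving no variable of \<open>A\<close> other than \<open>i\<close>.
  By the support condition \<open>x_i\<close> times all variables outside \<open>A\<close> lies in
  the ideal. Each of \<open>n\<close> variables of \<open>A\<close> in \<open>m\<close> is traded in
  this way, using up one layer of the cofactor.\<close>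

lemma cofactor_mult_mem_ideal_power:
  fixes L :: "'n::finite monomial set"
  assumes L: "up_closed L" "squarefree_monomials L" and A: "minimal_transversal L A"
  shows "n \<le> degree_in A m \<Longrightarrow>
    (single (cofactor_monomial A n + m) 1 :: ('n, 'k::comm_ring_1) mpoly) \<in> ideal_power (monomial_ideal L) n"
proof (induction n arbitrary: m)
  case (Suc n)
  then have "degree_in A m \<noteq> 0" by simp
  then obtain i where i: "i \<in> A" "lookup m i \<noteq> 0"
    unfolding degree_in_def by (metis sum.neutral)
  then obtain m' where m': "m = m' + single i 1"
    by (metis monomial_split_var)
  have "degree_in A m = Suc (degree_in A m')"
    using i(1) by (simp add: m' degree_in_def lookup_add lookup_single when_def sum.distrib)
  then have IH: "(single (cofactor_monomial A n + m') 1 :: ('n, 'k) mpoly) \<in> ideal_power (monomial_ideal L) n"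
    using Suc by simp
  have "\<not> transversal L (A - {i})" using A i(1) unfolding minimal_transversal_def by blast
  then obtain w where w: "w \<in> L" "\<And>j. j \<in> A - {i} \<Longrightarrow> lookup w j = 0"
    unfolding transversal_def by blast
  have "keys w \<subseteq> keys (cofactor_monomial A 1 + single i 1)"
    using w(2) by (force simp: in_keys_iff lookup_add lookup_single when_def cofactor_monomial_def)
  then have "cofactor_monomial A 1 + single i 1 \<in> L"
    using L(2) w(1) unfolding squarefree_monomials_def by blast
  then have g: "(single (cofactor_monomial A 1 + single i 1) 1 :: ('n, 'k) mpoly) \<in> monomial_ideal L"
    by simp
  have "cofactor_monomial A (Suc n) + m = (cofactor_monomial A 1 + single i 1) + (cofactor_monomial A n + m')"
    by (rule poly_mapping_eqI) (simp add: lookup_add cofactor_monomial_def m')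
  then show ?case
    using ideal_prod_mult[OF g IH] by (simp add: mult_single)
qed simp

text \<open>One denominator has to avoid all minimal primes at once. The sum of the cofactors does:
  its term for \<open>A\<close> is free of variables from \<open>A\<close>. Each term separately
  multiplies \<open>f\<close> into the power.\<close>

lemma symbolic_power_monomial_idealI:
  fixes f :: "('n::{finite,linorder}, 'k::field) mpoly"
  assumes L: "up_closed L" "0 \<notin> L" "squarefree_monomials L" and n: "n \<ge> 1"
    and f: "\<And>A m. minimal_transversal L A \<Longrightarrow> m \<in> keys f \<Longrightarrow> n \<le> degree_in A m"
  shows "f \<in> symbolic_power (monomial_ideal L) n"
proof -
  define s where "s = (\<Sum>A | minimal_transversal L A. single (cofactor_monomial A n) 1 :: ('n, 'k) mpoly)"
  have I: "ideal (ideal_power (monomial_ideal L :: ('n, 'k) mpoly set) n) ring_of_type_algebra"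
    by (intro ideal_power_ideal monomial_ideal_ideal L)
  \<comment> \<open>For \<open>n = 0\<close> all cofactors would be \<open>1\<close>, and their sum
    could vanish in positive characteristic; \<open>n \<ge> 1\<close> keeps them distinct, so
    nothing cancels.\<close>
  have inj: "A = B" if "cofactor_monomial A n = cofactor_monomial B n" for A B :: "'n set"
  proof -
    have "i \<in> A \<longleftrightarrow> i \<in> B" for i
      using arg_cong[OF that, of "\<lambda>m. lookup m i"] n by (simp add: cofactor_monomial_def split: if_splits)
    then show ?thesis by blast
  qed
  have "s \<notin> var_ideal A" if A: "minimal_transversal L A" for A
  proof -
    have "lookup s (cofactor_monomial A n) = (\<Sum>B | minimal_transversal L B. if B = A then 1 else 0)"
      unfolding s_def lookup_sum by (intro sum.cong) (auto simp: lookup_single when_def dest: inj)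
    then have "cofactor_monomial A n \<in> keys s" using A by (simp add: in_keys_iff)
    then show ?thesis by (auto simp: var_ideal_def monomial_ideal_def cofactor_monomial_def)
  qed
  moreover have "s * f \<in> ideal_power (monomial_ideal L) n"
  proof -
    have "single (cofactor_monomial A n) 1 * f \<in> ideal_power (monomial_ideal L) n"
      if A: "minimal_transversal L A" for A
    proof (rule mem_ideal_if_monomials[OF I])
      fix k assume "k \<in> keys (single (cofactor_monomial A n) 1 * f)"
      then obtain a m where "a \<in> keys (single (cofactor_monomial A n) (1::'k))" "m \<in> keys f" "k = a + m"
        by (rule keys_mult_subset)
      then show "(single k 1 :: ('n, 'k) mpoly) \<in> ideal_power (monomial_ideal L) n"
        using cofactor_mult_mem_ideal_power[OF L(1,3) A f[OF A]] by (simp split: if_splits)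
    qed
    then show ?thesis unfolding s_def sum_distrib_right by (intro ideal_sum[OF I]) simp
  qed
  ultimately show ?thesis unfolding mem_symbolic_power_monomial_ideal_iff[OF L(1,2)] by blast
qed

subsection \<open>Reducedness of the associated graded ring\<close>

text \<open>A power of \<open>x\<close> in \<open>J\<close> makes the coset of \<open>x\<close>
  nilpotent, hence zero in the reduced quotient.\<close>

lemma reduced_quotient_power_mem:
  fixes S J :: "'a::comm_ring_1 set"
  assumes J: "ideal J (subset_ring S)" and red: "reduced_ring (subset_ring S Quot J)"
    and x: "x \<in> S" "x ^ k \<in> J"
  shows "x \<in> J"
proof -
  let ?G = "subset_ring S Quot J"
  interpret J: ideal J "subset_ring S" by (rule J)
  interpret h: ring_hom_ring "subset_ring S" ?G "(+>\<^bsub>subset_ring S\<^esub>) J" by (rule J.rcos_ring_hom_ring)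
  have pow: "x [^]\<^bsub>subset_ring S\<^esub> k = x ^ k" for k :: nat
    by (induction k) (simp_all add: mult.commute)
  have zero: "\<zero>\<^bsub>?G\<^esub> = J" by (simp add: FactRing_def)
  have xk: "x ^ k \<in> S" using J.Icarr[OF x(2)] by simp
  have "(J +>\<^bsub>subset_ring S\<^esub> x) [^]\<^bsub>?G\<^esub> k = J +>\<^bsub>subset_ring S\<^esub> (x ^ k)"
    using h.hom_nat_pow[of x k] x(1) by (simp add: pow)
  also have "J +>\<^bsub>subset_ring S\<^esub> (x ^ k) = \<zero>\<^bsub>?G\<^esub>"
    unfolding zero by (rule J.a_coset_join2) (use xk x(2) J.a_subgroup in simp_all)
  finally have "(J +>\<^bsub>subset_ring S\<^esub> x) [^]\<^bsub>?G\<^esub> k = \<zero>\<^bsub>?G\<^esub>" .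
  moreover have "J +>\<^bsub>subset_ring S\<^esub> x \<in> carrier ?G"
    using h.hom_closed[of x] x(1) by simp
  ultimately have "J +>\<^bsub>subset_ring S\<^esub> x = \<zero>\<^bsub>?G\<^esub>"
    using red unfolding reduced_ring_def by metis
  then show ?thesis
    unfolding zero by (intro J.rcos_const_imp_mem) (use x(1) in simp_all)
qed

lemma graded_sum_shift_ideal:
  fixes I :: "nat \<Rightarrow> 'a::comm_ring_1 set"
  assumes S: "ring (subset_ring (graded_sum I))" and I: "\<And>n. ideal (I n) ring_of_type_algebra"
    and dec: "\<And>n. I (n + 1) \<subseteq> I n"
    and mult: "\<And>m n x y. x \<in> I m \<Longrightarrow> y \<in> I n \<Longrightarrow> x * y \<in> I (m + n)"
  shows "ideal (graded_sum (\<lambda>n. I (n + 1))) (subset_ring (graded_sum I))"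
  unfolding ideal_subset_ring_iff[OF S]
proof (intro conjI ballI)
  have zero: "0 \<in> I n" and add: "x \<in> I n \<Longrightarrow> y \<in> I n \<Longrightarrow> x + y \<in> I n" for x y n
    using I[of n] unfolding ideal_iff by blast+
  show "graded_sum (\<lambda>n. I (n + 1)) \<subseteq> graded_sum I"
  proof
    fix f assume "f \<in> graded_sum (\<lambda>n. I (n + 1))"
    then have "Polynomial.coeff f n \<in> I n" for n
      by (intro subsetD[OF dec[of n]]) (simp add: graded_sum_def)
    then show "f \<in> graded_sum I" by (simp add: graded_sum_def)
  qed
  show "0 \<in> graded_sum (\<lambda>n. I (n + 1))" by (simp add: graded_sum_def zero)
  fix f assume f: "f \<in> graded_sum (\<lambda>n. I (n + 1))"
  show "f + g \<in> graded_sum (\<lambda>n. I (n + 1))" if "g \<in> graded_sum (\<lambda>n. I (n + 1))" for g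
    using f that by (simp add: graded_sum_def add)
  fix r assume r: "r \<in> graded_sum I"
  have "Polynomial.coeff (r * f) n \<in> I (n + 1)" for n
    unfolding coeff_mult
  proof (rule ideal_sum[OF I])
    fix i assume "i \<in> {..n}"
    \<comment> \<open>The extra unit in the filtration comes from the coefficient of
      \<open>f\<close>.\<close>
    then have "i + (n - i + 1) = n + 1" by simp
    moreover have "Polynomial.coeff r i * Polynomial.coeff f (n - i) \<in> I (i + (n - i + 1))"
      using r f by (intro mult) (simp_all add: graded_sum_def)
    ultimately show "Polynomial.coeff r i * Polynomial.coeff f (n - i) \<in> I (n + 1)"
      by (simp only:)
  qed
  then show "r * f \<in> graded_sum (\<lambda>n. I (n + 1))" by (simp add: graded_sum_def)
qed

lemma monom_mem_graded_sum_iff: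
  assumes "\<And>n. 0 \<in> I n"
  shows "Polynomial.monom x n \<in> graded_sum I \<longleftrightarrow> x \<in> I n"
  using assms by (auto simp: graded_sum_def)

text \<open>The class of \<open>x T^n\<close> in the quotient is nilpotent: its \<open>k\<close>-th
  power is \<open>x^k T^(n k)\<close>, and \<open>x^k\<close> lies one step deeper in the filtration
  than its degree requires.\<close>

lemma reduced_associated_graded:
  fixes I :: "nat \<Rightarrow> 'a::comm_ring_1 set"
  assumes S: "ring (subset_ring (graded_sum I))" and I: "\<And>n. ideal (I n) ring_of_type_algebra"
    and dec: "\<And>n. I (n + 1) \<subseteq> I n"
    and mult: "\<And>m n x y. x \<in> I m \<Longrightarrow> y \<in> I n \<Longrightarrow> x * y \<in> I (m + n)"
    and red: "reduced_ring (subset_ring (graded_sum I) Quot graded_sum (\<lambda>n. I (n + 1)))"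
    and x: "x \<in> I n" "x ^ k \<in> I (n * k + 1)"
  shows "x \<in> I (n + 1)"
proof -
  have 0: "0 \<in> I n" for n using I[of n] unfolding ideal_iff by blast
  have "Polynomial.monom x n ^ k \<in> graded_sum (\<lambda>n. I (n + 1))"
    unfolding monom_power using x(2) by (subst monom_mem_graded_sum_iff) (auto simp: 0)
  moreover have "Polynomial.monom x n \<in> graded_sum I"
    using x(1) by (subst monom_mem_graded_sum_iff) (auto simp: 0)
  ultimately have "Polynomial.monom x n \<in> graded_sum (\<lambda>n. I (n + 1))"
    using reduced_quotient_power_mem[OF graded_sum_shift_ideal[OF S I dec mult] red] by blast
  then show ?thesis
    using monom_mem_graded_sum_iff[of "\<lambda>n. I (n + 1)" x n, OF 0] by simp
qed

section \<open>Comparison of the two filtrations\<close>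

text \<open>Differentiating by the \<open>A\<close>-part of \<open>m\<close> subtracts a fixed
  exponent, so the rest of \<open>m\<close> becomes the leading monomial of an element of
  \<open>P\<close>. It is disjoint from \<open>A\<close>, contradicting transversality.\<close>

lemma leading_monomial_symbolic_power_degree_ge:
  fixes P :: "('n::{finite,linorder}, 'k::field) mpoly set"
  assumes ord: "monomial_order ord" and P: "primeideal P ring_of_type_algebra"
    and m: "m \<in> leading_monomials ord (symbolic_power P n)"
    and A: "transversal (leading_monomials ord P) A"
  shows "n \<le> degree_in A m"
proof (rule ccontr)
  assume neg: "\<not> n \<le> degree_in A m"
  obtain f where f: "f \<in> symbolic_power P n" "is_leading_monomial ord f m"
    using m by (auto simp: leading_monomials_def)
  define g where "g = lookup (taylor A f) (restrict_monomial A m)"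
  have "g \<in> P"
    unfolding g_def
    by (rule lookup_taylor_symbolic_power[OF P f(1)]) (use neg in \<open>simp add: monomial_degree_restrict\<close>)
  moreover have "is_leading_monomial ord g (restrict_monomial (- A) m)"
    unfolding is_leading_monomial_def
  proof
    show "restrict_monomial (- A) m \<in> keys g"
      unfolding g_def by (rule restrict_mem_keys_lookup_taylor) (use f(2) in \<open>simp add: is_leading_monomial_def\<close>)
    show "\<forall>k\<in>keys g. ord k (restrict_monomial (- A) m)"
    proof
      fix k assume "k \<in> keys g"
      then have "restrict_monomial A m + k \<in> keys f" unfolding g_def by (rule keys_lookup_taylor)
      then have "ord (restrict_monomial A m + k) (restrict_monomial A m + restrict_monomial (- A) m)"
        using f(2) by (simp add: is_leading_monomial_def restrict_monomial_Compl)
      then show "ord k (restrict_monomial (- A) m)" by (rule ord_add_cancel[OF ord])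
    qed
  qed
  ultimately have "restrict_monomial (- A) m \<in> leading_monomials ord P"
    by (auto simp: leading_monomials_def)
  then show False using A unfolding transversal_def by force
qed

text \<open>
  For the linear form \<open>l\<close> dominating the order function on the face of \<open>w\<close>, the support of \<open>l\<close>
  together with the variables outside of this face is a transversal.
\<close>
lemma order_filtration_mem:
  fixes L :: "nat \<Rightarrow> 'n::finite monomial set"
  assumes L0: "L 0 = UNIV" and dec: "\<And>n. L (Suc n) \<subseteq> L n"
    and add: "\<And>m n a b. a \<in> L m \<Longrightarrow> b \<in> L n \<Longrightarrow> a + b \<in> L (m + n)"
    and homogeneous: "\<And>n k a. a \<in> L n \<Longrightarrow> monomial_of (\<lambda>i. k * lookup a i) \<in> L (n * k + 1) \<Longrightarrow> a \<in> L (Suc n)"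
    and bounded: "\<And>a. \<exists>N. \<forall>n. a \<in> L n \<longrightarrow> n \<le> N"
    and w: "\<And>A. minimal_transversal (L 1) A \<Longrightarrow> n \<le> degree_in A w"
  shows "w \<in> L n"
proof -
  \<comment> \<open>The order of a monomial in the filtration; the maximum exists because level
    \<open>0\<close> is everything and \<open>bounded\<close> limits the levels.\<close>
  define v where "v f = (GREATEST n. monomial_of f \<in> L n)" for f :: "'n \<Rightarrow> nat"
  have v_mem: "monomial_of f \<in> L (v f)" and v_ge: "monomial_of f \<in> L n \<Longrightarrow> n \<le> v f" for f n
  proof -
    obtain N where N: "\<forall>n. monomial_of f \<in> L n \<longrightarrow> n \<le> N" using bounded by blast
    show "monomial_of f \<in> L (v f)"
      unfolding v_def by (rule GreatestI_nat[of _ 0 N]) (use N L0 in auto)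
    show "monomial_of f \<in> L n \<Longrightarrow> n \<le> v f"
      unfolding v_def by (rule Greatest_le_nat[of _ _ N]) (use N in auto)
  qed
  have anti: "L n \<subseteq> L m" if "m \<le> n" for m n
    using that by (rule lift_Suc_antimono_le[of L, OF dec])
  have scale_mem: "monomial_of (\<lambda>i. k * f i) \<in> L (n * k)" if f: "monomial_of f \<in> L n" for f n k
  proof (induction k)
    case 0
    then show ?case by (simp add: L0)
  next
    case (Suc k)
    have "monomial_of (\<lambda>i. Suc k * f i) = monomial_of f + monomial_of (\<lambda>i. k * f i)"
      by (rule poly_mapping_eqI) (simp add: lookup_add)
    then show ?case using add[OF f Suc] by simp
  qed
  have v_add: "v f + v g \<le> v (\<lambda>i. f i + g i)" for f g
  proof (rule v_ge)
    have "monomial_of (\<lambda>i. f i + g i) = monomial_of f + monomial_of g"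
      by (rule poly_mapping_eqI) (simp add: lookup_add)
    then show "monomial_of (\<lambda>i. f i + g i) \<in> L (v f + v g)" using add[OF v_mem v_mem] by simp
  qed
  have v_scale: "v (\<lambda>i. k * f i) = k * v f" for k f
  proof (rule antisym)
    show "k * v f \<le> v (\<lambda>i. k * f i)"
      using v_ge[OF scale_mem[OF v_mem[of f]], of k] by (simp add: mult.commute)
    show "v (\<lambda>i. k * f i) \<le> k * v f"
    proof (rule ccontr)
      \<comment> \<open>If the multiple \<open>k f\<close> had larger order than expected, it would
        lie in level \<open>v f * k + 1\<close>, and \<open>homogeneous\<close> would push
        \<open>f\<close> itself above its maximal level.\<close>
      assume "\<not> ?thesis"
      then have "monomial_of (\<lambda>i. k * f i) \<in> L (v f * k + 1)"
        using anti[of "v f * k + 1" "v (\<lambda>i. k * f i)"] v_mem[of "\<lambda>i. k * f i"]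
        by (auto simp: mult.commute)
      then have "monomial_of f \<in> L (Suc (v f))"
        using homogeneous[OF v_mem[of f]] by simp
      then show False using v_ge[of f "Suc (v f)"] by simp
    qed
  qed
  obtain l where l: "v (lookup w) = (\<Sum>i\<in>UNIV. l i * lookup w i)"
    "\<And>a. (\<And>i. lookup w i = 0 \<Longrightarrow> a i = 0) \<Longrightarrow> v a \<le> (\<Sum>i\<in>UNIV. l i * a i)"
    by (rule superadditive_dominated_linear[of v "lookup w", OF v_add v_scale]) blast
  define A where "A = {i. lookup w i = 0 \<or> l i \<noteq> 0}"
  have "transversal (L 1) A"
    unfolding transversal_def
  proof
    fix a assume a: "a \<in> L 1"
    show "\<exists>i\<in>A. lookup a i \<noteq> 0"
    proof (cases "\<exists>i. lookup w i = 0 \<and> lookup a i \<noteq> 0")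
      case False
      \<comment> \<open>Here \<open>a\<close> lies on the face of \<open>w\<close>, so the form
        dominates its positive order and some \<open>l i * lookup a i\<close> is nonzero.\<close>
      have "1 \<le> v (lookup a)" using v_ge[of "lookup a" 1] a by simp
      moreover have "v (lookup a) \<le> (\<Sum>i\<in>UNIV. l i * lookup a i)" using False by (intro l(2)) blast
      ultimately have "(\<Sum>i\<in>UNIV. l i * lookup a i) \<noteq> 0" by linarith
      then show ?thesis by (auto simp: A_def)
    qed (auto simp: A_def)
  qed
  then obtain B where B: "B \<subseteq> A" "minimal_transversal (L 1) B" by (rule minimal_transversal_exists)
  have "n \<le> degree_in B w" by (rule w[OF B(2)])
  \<comment> \<open>For \<open>i\<close> in \<open>B\<close> either \<open>w\<close> vanishes at
    \<open>i\<close> or the natural number \<open>l i\<close> is at least \<open>1\<close>;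
    integrality of the form enters here.\<close>
  moreover have "degree_in B w \<le> (\<Sum>i\<in>B. l i * lookup w i)"
    unfolding degree_in_def using B(1) by (intro sum_mono) (auto simp: A_def)
  moreover have "(\<Sum>i\<in>B. l i * lookup w i) \<le> v (lookup w)"
    unfolding l(1) by (intro sum_mono2) auto
  ultimately have "n \<le> v (lookup w)" by linarith
  then show ?thesis using anti v_mem[of "lookup w"] by auto
qed

theorem corollary7p10:
  fixes ord :: "'n::{finite,linorder} monomial \<Rightarrow> 'n monomial \<Rightarrow> bool"
    and P :: "('n, 'k::field) mpoly set"
    and S J B :: "('n, 'k) mpoly poly set"
    and p :: nat
  assumes "perfect_field TYPE('k)" and "CHAR('k) = p" and "p > 0"
    and "monomial_order ord"
    and "primeideal P ring_of_type_algebra" and "homogeneous_ideal P"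
    and "radical_ideal (initial_ideal ord P)"
    and "S = graded_sum (\<lambda>n. initial_ideal ord (symbolic_power P n))"
    and "J = graded_sum (\<lambda>n. initial_ideal ord (symbolic_power P (n + 1)))"
    and "noetherian_ring (subset_ring S)"
    and "finite B" and "minimal_homogeneous_generators S B"
    and "p > Lcm (Polynomial.degree ` B)"
    and "reduced_ring (subset_ring S Quot J)"
  shows "\<forall>n\<ge>1. initial_ideal ord (symbolic_power P n) = symbolic_power (initial_ideal ord P) n"
proof (intro allI impI)
  fix n :: nat assume n: "n \<ge> 1"
  note ord = \<open>monomial_order ord\<close> and P = \<open>primeideal P ring_of_type_algebra\<close>
  have I: "ideal P ring_of_type_algebra" and P1: "1 \<notin> P"
    using P unfolding primeideal_iff by blast+
  define K where "K = leading_monomials ord P"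
  define L where "L n = leading_monomials ord (symbolic_power P n)" for n
  have in_P: "initial_ideal ord P = monomial_ideal K"
    unfolding K_def by (rule initial_ideal_eq[OF ord I])
  have in_sym: "initial_ideal ord (symbolic_power P n) = monomial_ideal (L n)" for n
    unfolding L_def by (rule initial_ideal_eq[OF ord symbolic_power_ideal[OF P]])
  have upL: "up_closed (L n)" for n
    unfolding L_def by (rule up_closed_leading_monomials[OF ord symbolic_power_ideal[OF P]])
  have upK: "up_closed K" and 0: "0 \<notin> K"
    unfolding K_def by (rule up_closed_leading_monomials[OF ord I] zero_notin_leading_monomials[OF ord I P1])+
  have sqfree: "squarefree_monomials K"
    using \<open>radical_ideal (initial_ideal ord P)\<close> upK unfolding in_P by (rule squarefree_monomialsI)
  have L0: "L 0 = UNIV"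
    using is_leading_monomial_single[OF ord, where ?'k = 'k]
    unfolding L_def leading_monomials_def symbolic_power_0[OF P] by blast
  have L_Suc: "L (Suc n) \<subseteq> L n" for n
    unfolding L_def leading_monomials_def using symbolic_power_Suc_subset[OF P, of n] by blast
  have L_add: "a + b \<in> L (m + n)" if "a \<in> L m" "b \<in> L n" for a b m n
    using that unfolding L_def by (rule leading_monomials_mult[OF ord _ _ symbolic_power_mult[OF P]])
  have K_L: "K \<subseteq> L 1"
    unfolding K_def L_def leading_monomials_def using subset_symbolic_power_1[OF P] by blast
  have bound: "n \<le> degree_in A m" if "m \<in> L n" "minimal_transversal K A" for m n A
    using that unfolding L_def K_def minimal_transversal_def
    by (intro leading_monomial_symbolic_power_degree_ge[OF ord P]) auto
  have homogeneous: "a \<in> L (Suc n)"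
    if a: "a \<in> L n" and ka: "monomial_of (\<lambda>i. k * lookup a i) \<in> L (n * k + 1)" for n k a
  proof -
    have "(single a 1 :: ('n, 'k) mpoly) \<in> monomial_ideal (L (n + 1))"
    proof (rule reduced_associated_graded)
      \<comment> \<open>That \<open>S\<close> is a ring is contained in the Noetherian
        hypothesis.\<close>
      show "ring (subset_ring (graded_sum (\<lambda>n. monomial_ideal (L n) :: ('n, 'k) mpoly set)))"
        using \<open>noetherian_ring (subset_ring S)\<close>
        unfolding \<open>S = _\<close> in_sym by (rule noetherian_ring.axioms)
      show "reduced_ring (subset_ring (graded_sum (\<lambda>n. monomial_ideal (L n) :: ('n, 'k) mpoly set)) Quot
          graded_sum (\<lambda>n. monomial_ideal (L (n + 1))))"
        using \<open>reduced_ring (subset_ring S Quot J)\<close> unfolding \<open>S = _\<close> \<open>J = _\<close> in_sym .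
      show "(single a 1 :: ('n, 'k) mpoly) \<in> monomial_ideal (L n)" using a by simp
      show "(single a 1 :: ('n, 'k) mpoly) ^ k \<in> monomial_ideal (L (n * k + 1))"
        using ka by (simp add: single_power)
      show "monomial_ideal (L (n + 1)) \<subseteq> (monomial_ideal (L n) :: ('n, 'k) mpoly set)" for n
        using L_Suc[of n] by (auto simp: monomial_ideal_def)
      show "x * y \<in> monomial_ideal (L (m + n))"
        if "x \<in> monomial_ideal (L m)" "y \<in> monomial_ideal (L n)" for m n and x y :: "('n, 'k) mpoly"
        using that L_add by (rule monomial_ideal_mult)
    qed (rule monomial_ideal_ideal[OF upL])
    then show ?thesis by simp
  qed
  \<comment> \<open>The degree along any one minimal transversal bounds the order of a monomial, so
    orders are finite.\<close>
  obtain A0 where A0: "minimal_transversal K A0"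
    using minimal_transversal_exists[OF transversal_UNIV[OF 0]] .
  show "initial_ideal ord (symbolic_power P n) = symbolic_power (initial_ideal ord P) n"
    unfolding in_sym in_P
  proof (intro equalityI subsetI)
    fix f :: "('n, 'k) mpoly" assume f: "f \<in> monomial_ideal (L n)"
    show "f \<in> symbolic_power (monomial_ideal K) n"
      by (rule symbolic_power_monomial_idealI[OF upK 0 sqfree n])
         (use f bound in \<open>auto simp: monomial_ideal_def\<close>)
  next
    fix f :: "('n, 'k) mpoly" assume f: "f \<in> symbolic_power (monomial_ideal K) n"
    have "m \<in> L n" if m: "m \<in> keys f" for m
    proof (rule order_filtration_mem[of L, OF L0 L_Suc L_add homogeneous])
      show "\<exists>N. \<forall>n. a \<in> L n \<longrightarrow> n \<le> N" for a using bound[OF _ A0] by blast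
      fix A assume "minimal_transversal (L 1) A"
      \<comment> \<open>\<open>A\<close> is minimal for the possibly larger set \<open>L 1\<close>.
        It still covers \<open>K\<close>, so it contains a minimal transversal of \<open>K\<close>,
        and passing to the larger set can only increase the degree.\<close>
      then have "transversal K A" using K_L unfolding minimal_transversal_def transversal_def by blast
      then obtain B where B: "B \<subseteq> A" "minimal_transversal K B" by (rule minimal_transversal_exists)
      have "n \<le> degree_in B m" by (rule symbolic_power_monomial_ideal_degree_ge[OF upK 0 f B(2) m])
      also have "degree_in B m \<le> degree_in A m"
        unfolding degree_in_def using B(1) by (intro sum_mono2) auto
      finally show "n \<le> degree_in A m" .
    qed
    then show "f \<in> monomial_ideal (L n)" by (auto simp: monomial_ideal_def)
  qed
qed

end
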